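(* Let $G$ be a finitely generated, infinite group. The following are equivalent: (1) $G$ is virtually-$\mathbb{Z}$. (2) For any Cayley metric $d_S$ on $G$, the metric-functional boundary $\partial(G,d_S)$ is finite. (3) There exists a Cayley metric $d_S$ on $G$ such that the set of Busemann points $\partial_b(G,d_S)$ is finite.
   Context: A group $G$ is virtually-$\mathbb{Z}$ if it has a finite index subgroup $H$ with $H\cong\mathbb{Z}$ (the additive group of integers). Cayley metric: for a finite symmetric generating set $S$ of $G$, the Cayley graph $\Gamma(G,S)$ has vertex set $G$ and edges $\{x,xs\}$ for $x\in G$, $s\in S$; $d_S$ is its graph metric. A Cayley metric is any metric of the form $d_S$ with $S$ a finite symmetric generating set. Metric-functional boundary: for a metric $d$ on $G$ and $x\in G$ let $b_x\colon G\to\mathbb{R}$, $b_x(y)=d(x,y)-d(x,1)$. Let $\overline{(G,d)}$ be the closure of $\{b_x : x\in G\}$ in the space of functions $G\to\mathbb{R}$ with the topology of pointwise convergence. Then $\partial(G,d)=\overline{(G,d)}\setminus\{b_x : x\in G\}$. Busemann points: an infinite geodesic in $(G,d_S)$ is a sequence $\gamma=(\gamma_n)_{n\ge 0}$ in $G$ with $d_S(\gamma_i,\gamma_j)=|i-j|$ for all $i,j\ge 0$. For such $\gamma$, the pointwise limit $\gamma_\infty=\lim_n b_{\gamma_n}$ exists and lies in $\partial(G,d_S)$. A Busemann point is an element of the form $\gamma_\infty$ for some infinite geodesic $\gamma$ (with arbitrary starting point), and $\partial_b(G,d_S)$ is the set of all Busemann points. *)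

theory Defs
  imports "HOL-Algebra.Algebra" "HOL-Analysis.Analysis"
begin

definition finitely_generated_group :: "('a, 'b) monoid_scheme \<Rightarrow> bool" where
  "finitely_generated_group G \<longleftrightarrow>
     (\<exists>S. finite S \<and> S \<subseteq> carrier G \<and> generate G S = carrier G)"

definition virtually_Z :: "('a, 'b) monoid_scheme \<Rightarrow> bool" where
  "virtually_Z G \<longleftrightarrow>
     (\<exists>H. subgroup H G \<and> finite (rcosets\<^bsub>G\<^esub> H) \<and> G\<lparr>carrier := H\<rparr> \<cong> integer_group)"

definition finite_symmetric_generating_set ::
  "('a, 'b) monoid_scheme \<Rightarrow> 'a set \<Rightarrow> bool" where
  "finite_symmetric_generating_set G S \<longleftrightarrow>
     finite S \<and> S \<subseteq> carrier G \<and> (\<forall>s\<in>S. inv\<^bsub>G\<^esub> s \<in> S) \<and> generate G S = carrier G"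

definition cayley_edges :: "('a, 'b) monoid_scheme \<Rightarrow> 'a set \<Rightarrow> 'a set set" where
  "cayley_edges G S = {{x, x \<otimes>\<^bsub>G\<^esub> s} | x s. x \<in> carrier G \<and> s \<in> S}"

text \<open>
  Length of a shortest walk between two vertices, where \<open>R ^^ n\<close> relates the endpoints of walks
  of length \<open>n\<close>. The value is unspecified for vertices in different components; this does not
  occur inside the connected Cayley graph of a generating set.
\<close>
definition graph_dist :: "'a set set \<Rightarrow> 'a \<Rightarrow> 'a \<Rightarrow> nat" where
  "graph_dist E x y = (LEAST n. (x, y) \<in> {(u, v). {u, v} \<in> E} ^^ n)"

definition cayley_dist :: "('a, 'b) monoid_scheme \<Rightarrow> 'a set \<Rightarrow> 'a \<Rightarrow> 'a \<Rightarrow> real" where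
  "cayley_dist G S x y = real (graph_dist (cayley_edges G S) x y)"

text \<open>
  Real functions on the group are represented by functions that are \<^const>\<open>undefined\<close> outside
  \<open>carrier G\<close>, which are the points of the space \<open>powertop_real (carrier G)\<close>. Its topology is that
  of pointwise convergence.
\<close>
definition metric_functional ::
  "('a, 'b) monoid_scheme \<Rightarrow> ('a \<Rightarrow> 'a \<Rightarrow> real) \<Rightarrow> 'a \<Rightarrow> 'a \<Rightarrow> real" where
  "metric_functional G d x = (\<lambda>y\<in>carrier G. d x y - d x \<one>\<^bsub>G\<^esub>)"

definition metric_functional_boundary ::
  "('a, 'b) monoid_scheme \<Rightarrow> ('a \<Rightarrow> 'a \<Rightarrow> real) \<Rightarrow> ('a \<Rightarrow> real) set" where
  "metric_functional_boundary G d =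
     powertop_real (carrier G) closure_of (metric_functional G d ` carrier G)
       - metric_functional G d ` carrier G"

definition infinite_geodesic ::
  "('a, 'b) monoid_scheme \<Rightarrow> ('a \<Rightarrow> 'a \<Rightarrow> real) \<Rightarrow> (nat \<Rightarrow> 'a) \<Rightarrow> bool" where
  "infinite_geodesic G d \<gamma> \<longleftrightarrow>
     range \<gamma> \<subseteq> carrier G \<and> (\<forall>i j. d (\<gamma> i) (\<gamma> j) = \<bar>real i - real j\<bar>)"

definition busemann_points ::
  "('a, 'b) monoid_scheme \<Rightarrow> ('a \<Rightarrow> 'a \<Rightarrow> real) \<Rightarrow> ('a \<Rightarrow> real) set" where
  "busemann_points G d =
     {h. \<exists>\<gamma>. infinite_geodesic G d \<gamma> \<and>
        limitin (powertop_real (carrier G)) (\<lambda>n. metric_functional G d (\<gamma> n)) h sequentially}"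

end

theory Submission
  imports Defs
begin

text \<open>
  If \<open>G\<close> is virtually \<open>\<int>\<close>, a coarse height function \<open>G \<rightarrow> \<int>\<close> shows that every finite window is
  separated from each of the two ends by a translate of one fixed finite set. A boundary point is
  determined on the window by its restriction to such a translate, for which there are, up to a
  constant, boundedly many possibilities; so the boundary is finite.

  Conversely, let there be finitely many Busemann points. A subgroup \<open>N\<close> of finite index fixes all of
  them, and they restrict to homomorphisms on \<open>N\<close>. For a nonzero homomorphism \<open>\<psi>\<close> on \<open>N\<close>, a geodesic
  ray along which \<open>\<psi>\<close> grows as fast as possible has a Busemann point \<open>h\<close> with \<open>\<psi> = - l h\<close>, \<open>l > 0\<close>. As
  there are only finitely many \<open>h\<close>, all Busemann points are proportional on \<open>N\<close>. Hence any Busemann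
  point \<open>h\<close> moves quickly along every window of a long geodesic, and it cannot turn back. So the
  level sets of \<open>h\<close> are finite, and any \<open>x \<in> N\<close> with \<open>h x \<noteq> 0\<close> generates an infinite cyclic subgroup of
  finite index.
\<close>

section \<open>Geodesic metrics on groups\<close>

text \<open>These are the properties of word metrics on which the whole argument rests. Distances
  are natural numbers, and \<open>d_between\<close> expresses that any two points are joined by a
  discrete geodesic.\<close>

locale geodesic_group_metric = group G
  for G :: "('a, 'b) monoid_scheme" (structure) +
  fixes d :: "'a \<Rightarrow> 'a \<Rightarrow> nat"
  assumes d_eq_0: "\<lbrakk>x \<in> carrier G; y \<in> carrier G\<rbrakk> \<Longrightarrow> d x y = 0 \<longleftrightarrow> x = y"
    and d_sym: "\<lbrakk>x \<in> carrier G; y \<in> carrier G\<rbrakk> \<Longrightarrow> d x y = d y x"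
    and d_triangle:
      "\<lbrakk>x \<in> carrier G; y \<in> carrier G; z \<in> carrier G\<rbrakk> \<Longrightarrow> d x z \<le> d x y + d y z"
    and d_left_mult:
      "\<lbrakk>a \<in> carrier G; x \<in> carrier G; y \<in> carrier G\<rbrakk> \<Longrightarrow> d (a \<otimes> x) (a \<otimes> y) = d x y"
    and d_between:
      "\<lbrakk>x \<in> carrier G; y \<in> carrier G; k \<le> d x y\<rbrakk>
        \<Longrightarrow> \<exists>z\<in>carrier G. d x z = k \<and> d z y = d x y - k"
    and finite_ball_one: "finite {y \<in> carrier G. d \<one> y \<le> n}"

section \<open>Word metrics of Cayley graphs\<close>

context group
begin

definition cayley_step :: "'a set \<Rightarrow> ('a \<times> 'a) set" where
  "cayley_step S = {(u, v). {u, v} \<in> cayley_edges G S}"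

context
  fixes S assumes S: "finite_symmetric_generating_set G S"
begin

lemma gen_carrier: "s \<in> S \<Longrightarrow> s \<in> carrier G"
  and gen_inv: "s \<in> S \<Longrightarrow> inv s \<in> S"
  and gen_finite: "finite S"
  and gen_generate: "generate G S = carrier G"
  using S unfolding finite_symmetric_generating_set_def by auto

text \<open>Edges are unordered pairs; reading one backwards is again a right multiplication by a
  generator because \<open>S\<close> is closed under inverses.\<close>

lemma cayley_step_iff: "(u, v) \<in> cayley_step S \<longleftrightarrow> u \<in> carrier G \<and> (\<exists>s\<in>S. v = u \<otimes> s)"
proof
  assume "(u, v) \<in> cayley_step S"
  then obtain x s where xs: "x \<in> carrier G" "s \<in> S" "{u, v} = {x, x \<otimes> s}"
    unfolding cayley_edges_def cayley_step_def by auto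
  then consider "u = x" "v = x \<otimes> s" | "u = x \<otimes> s" "v = x"
    by (auto simp: doubleton_eq_iff)
  then show "u \<in> carrier G \<and> (\<exists>s\<in>S. v = u \<otimes> s)"
  proof cases
    case 2
    then have "v = u \<otimes> inv s"
      using xs gen_carrier by (simp add: m_assoc)
    then show ?thesis
      using 2 xs gen_carrier gen_inv by auto
  qed (use xs in auto)
qed (auto simp: cayley_edges_def cayley_step_def)

lemma relpow_step_carrier:
  "(x, y) \<in> cayley_step S ^^ n \<Longrightarrow> x \<in> carrier G \<Longrightarrow> y \<in> carrier G"
  by (induction n arbitrary: y) (auto simp: cayley_step_iff gen_carrier)

lemma relpow_step_sym: "(x, y) \<in> cayley_step S ^^ n \<Longrightarrow> (y, x) \<in> cayley_step S ^^ n"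
proof (induction n arbitrary: y)
  case (Suc n)
  then obtain z where z: "(x, z) \<in> cayley_step S ^^ n" "(z, y) \<in> cayley_step S"
    by auto
  have "(y, z) \<in> cayley_step S"
    using z(2) by (simp add: cayley_step_def insert_commute)
  then show ?case
    using Suc.IH[OF z(1)] by (rule relpow_Suc_I2)
qed simp

lemma relpow_step_left_mult:
  assumes "a \<in> carrier G" "x \<in> carrier G"
  shows "(x, y) \<in> cayley_step S ^^ n \<Longrightarrow> (a \<otimes> x, a \<otimes> y) \<in> cayley_step S ^^ n"
proof (induction n arbitrary: y)
  case (Suc n)
  then obtain z where z: "(x, z) \<in> cayley_step S ^^ n" "(z, y) \<in> cayley_step S"
    by (auto elim: relpow_Suc_E)
  then have "z \<in> carrier G"
    using assms relpow_step_carrier by blast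
  then have "(a \<otimes> z, a \<otimes> y) \<in> cayley_step S"
    using z(2) assms gen_carrier unfolding cayley_step_iff by (auto simp: m_assoc)
  then show ?case
    using Suc.IH[OF z(1)] by (rule relpow_Suc_I[rotated])
qed simp

lemma relpow_step_one: "g \<in> generate G S \<Longrightarrow> \<exists>n. (\<one>, g) \<in> cayley_step S ^^ n"
proof (induction g rule: generate.induct)
  case one
  then show ?case by (metis relpow_0_I)
next
  case (incl h)
  then have "(\<one>, h) \<in> cayley_step S"
    unfolding cayley_step_iff using gen_carrier by force
  then show ?case by (metis relpow_1)
next
  case (inv h)
  then have "(\<one>, inv h) \<in> cayley_step S"
    unfolding cayley_step_iff using gen_carrier gen_inv by force
  then show ?case by (metis relpow_1)
next
  case (eng h1 h2)
  then obtain m n where mn: "(\<one>, h1) \<in> cayley_step S ^^ m" "(\<one>, h2) \<in> cayley_step S ^^ n"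
    by blast
  have "h1 \<in> carrier G"
    using mn relpow_step_carrier by blast
  then have "(h1, h1 \<otimes> h2) \<in> cayley_step S ^^ n"
    using relpow_step_left_mult[OF _ one_closed mn(2)] by fastforce
  then show ?case
    using mn(1) by (metis relcompI relpow_add)
qed

lemma relpow_step_connected:
  assumes "x \<in> carrier G" "y \<in> carrier G"
  shows "\<exists>n. (x, y) \<in> cayley_step S ^^ n"
proof -
  obtain n where "(\<one>, inv x \<otimes> y) \<in> cayley_step S ^^ n"
    using relpow_step_one gen_generate assms by (metis inv_closed m_closed)
  then have "(x, y) \<in> cayley_step S ^^ n"
    using relpow_step_left_mult[OF assms(1) one_closed] assms by (fastforce simp flip: m_assoc)
  then show ?thesis ..
qed

lemma graph_dist_walk:
  assumes "x \<in> carrier G" "y \<in> carrier G"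
  shows "(x, y) \<in> cayley_step S ^^ graph_dist (cayley_edges G S) x y"
  unfolding graph_dist_def cayley_step_def[symmetric] using relpow_step_connected[OF assms] by (rule LeastI_ex)

lemma graph_dist_le: "(x, y) \<in> cayley_step S ^^ n \<Longrightarrow> graph_dist (cayley_edges G S) x y \<le> n"
  unfolding graph_dist_def cayley_step_def[symmetric] by (rule Least_le)

lemma finite_relpow_step: "finite {y. (x, y) \<in> cayley_step S ^^ n}"
proof (induction n)
  case (Suc n)
  have "{y. (x, y) \<in> cayley_step S ^^ Suc n} \<subseteq> (\<lambda>(z, s). z \<otimes> s) ` ({y. (x, y) \<in> cayley_step S ^^ n} \<times> S)"
    by (force simp: cayley_step_iff)
  then show ?case
    using Suc gen_finite by (meson finite_SigmaI finite_imageI finite_subset)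
qed simp

lemma geodesic_group_metric_graph_dist: "geodesic_group_metric G (graph_dist (cayley_edges G S))"
proof unfold_locales
  let ?d = "graph_dist (cayley_edges G S)"
  fix x y assume xy: "x \<in> carrier G" "y \<in> carrier G"
  show "?d x y = 0 \<longleftrightarrow> x = y"
    using graph_dist_walk[OF xy] graph_dist_le[of x x 0] by auto
  show "?d x y = ?d y x"
    using graph_dist_walk xy relpow_step_sym graph_dist_le by (metis order_antisym)
  show tri: "?d x z \<le> ?d x y + ?d y z" if z: "z \<in> carrier G" for z
    using graph_dist_walk[OF xy] graph_dist_walk[OF xy(2) z]
    by (intro graph_dist_le) (auto simp: relpow_add)
  \<comment> \<open>The converse inequality is this one applied to \<open>inv a\<close>.\<close>
  have left: "?d (a \<otimes> x) (a \<otimes> y) \<le> ?d x y"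
    if "a \<in> carrier G" "x \<in> carrier G" "y \<in> carrier G" for a x y
    using that by (intro graph_dist_le relpow_step_left_mult graph_dist_walk)
  show "?d (a \<otimes> x) (a \<otimes> y) = ?d x y" if a: "a \<in> carrier G" for a
    using left[OF a xy] left[of "inv a" "a \<otimes> x" "a \<otimes> y"] a xy by (simp flip: m_assoc)
  show "\<exists>z\<in>carrier G. ?d x z = k \<and> ?d z y = ?d x y - k" if k: "k \<le> ?d x y" for k
  proof -
    have "(x, y) \<in> cayley_step S ^^ (k + (?d x y - k))"
      using graph_dist_walk[OF xy] k by simp
    then obtain z where z: "(x, z) \<in> cayley_step S ^^ k" "(z, y) \<in> cayley_step S ^^ (?d x y - k)"
      unfolding relpow_add by blast
    then have zc: "z \<in> carrier G"
      using relpow_step_carrier xy by blast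
    \<comment> \<open>Splitting the walk only bounds both distances from above; concatenating
      shortest walks through \<open>z\<close> makes the bounds equalities.\<close>
    have "(x, y) \<in> cayley_step S ^^ (?d x z + ?d z y)"
      using graph_dist_walk[OF xy(1) zc] graph_dist_walk[OF zc xy(2)] by (auto simp: relpow_add)
    then have "?d x y \<le> ?d x z + ?d z y"
      by (rule graph_dist_le)
    then show ?thesis
      using zc graph_dist_le[OF z(1)] graph_dist_le[OF z(2)] k by (intro bexI[of _ z]) auto
  qed
next
  fix n
  have "{y \<in> carrier G. graph_dist (cayley_edges G S) \<one> y \<le> n}
          \<subseteq> (\<Union>k\<le>n. {y. (\<one>, y) \<in> cayley_step S ^^ k})"
    using graph_dist_walk by blast
  then show "finite {y \<in> carrier G. graph_dist (cayley_edges G S) \<one> y \<le> n}"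
    by (rule finite_subset) (simp add: finite_relpow_step)
qed

end

end

section \<open>Geodesic rays and Busemann points\<close>

context geodesic_group_metric
begin

abbreviation D :: "'a \<Rightarrow> 'a \<Rightarrow> real" where
  "D \<equiv> \<lambda>x y. real (d x y)"

lemma d_self [simp]: "x \<in> carrier G \<Longrightarrow> d x x = 0"
  using d_eq_0 by blast

lemma finite_ball:
  assumes x: "x \<in> carrier G"
  shows "finite {y \<in> carrier G. d x y \<le> n}"
proof -
  have "{y \<in> carrier G. d x y \<le> n} \<subseteq> (\<otimes>) x ` {y \<in> carrier G. d \<one> y \<le> n}"
  proof clarify
    fix y assume y: "y \<in> carrier G" "d x y \<le> n"
    have "d \<one> (inv x \<otimes> y) = d x y"
      using d_left_mult[of "inv x" x y] x y by simp
    moreover have "y = x \<otimes> (inv x \<otimes> y)"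
      using x y by (simp flip: m_assoc)
    ultimately show "y \<in> (\<otimes>) x ` {y \<in> carrier G. d \<one> y \<le> n}"
      using x y by auto
  qed
  then show ?thesis
    using finite_ball_one finite_subset by blast
qed

lemma D_diff_le:
  assumes "x \<in> carrier G" "y \<in> carrier G" "z \<in> carrier G"
  shows "\<bar>D x y - D x z\<bar> \<le> D y z"
  using d_triangle[of x y z] d_triangle[of x z y] d_sym[of y z] assms by linarith

lemma d_one_mult:
  assumes "x \<in> carrier G" "y \<in> carrier G"
  shows "d \<one> (x \<otimes> y) \<le> d \<one> x + d \<one> y"
  using d_triangle[of \<one> x "x \<otimes> y"] d_left_mult[of x \<one> y] assms by simp

lemma d_one_inv_mult:
  "\<lbrakk>x \<in> carrier G; y \<in> carrier G\<rbrakk> \<Longrightarrow> d \<one> (inv x \<otimes> y) = d x y"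
  using d_left_mult[of x \<one> "inv x \<otimes> y"] by (simp flip: m_assoc)

lemma d_le_of_steps:
  assumes "\<And>n. p n \<in> carrier G" "\<And>n. d (p n) (p (Suc n)) \<le> 1"
  shows "d (p i) (p (i + k)) \<le> k"
proof (induction k)
  case (Suc k)
  then show ?case
    using d_triangle[of "p i" "p (i + k)" "p (i + Suc k)"] assms(2)[of "i + k"] assms(1) by force
qed (simp add: assms)

text \<open>Distances from \<open>p 0\<close> suffice: unit steps bound
  \<open>d (p i) (p (i + k))\<close> from above, and the triangle inequality through
  \<open>p i\<close> bounds it from below.\<close>

lemma infinite_geodesicI:
  assumes p: "\<And>n. p n \<in> carrier G" "\<And>n. d (p n) (p (Suc n)) \<le> 1" "\<And>n. d (p 0) (p n) = n"
  shows "infinite_geodesic G D p"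
proof -
  have *: "d (p i) (p (i + k)) = k" for i k
    using d_le_of_steps[of p i k, OF p(1,2)] d_triangle[of "p 0" "p i" "p (i + k)"] p(1,3) by force
  have "D (p i) (p j) = \<bar>real i - real j\<bar>" for i j
  proof (cases "i \<le> j")
    case True
    then show ?thesis using *[of i "j - i"] by simp
  next
    case False
    then show ?thesis using *[of j "i - j"] d_sym[OF p(1) p(1), of i j] by simp
  qed
  then show ?thesis
    using p(1) by (auto simp: infinite_geodesic_def)
qed

lemma infinite_geodesicD:
  assumes "infinite_geodesic G D p"
  shows "p i \<in> carrier G" "i \<le> j \<Longrightarrow> d (p i) (p j) = j - i"
proof -
  show "p i \<in> carrier G"
    using assms by (auto simp: infinite_geodesic_def)
  assume "i \<le> j"
  moreover have "D (p i) (p j) = \<bar>real i - real j\<bar>"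
    using assms by (auto simp: infinite_geodesic_def)
  ultimately show "d (p i) (p j) = j - i"
    by linarith
qed

text \<open>The path moves one unit towards \<open>v\<close> at each step. By truncated subtraction
  it rests at \<open>v\<close> after arrival, so it is defined for all indices.\<close>

lemma geodesic_segment:
  assumes u: "u \<in> carrier G" and v: "v \<in> carrier G"
  obtains p where "p 0 = u" "\<And>n. p n \<in> carrier G" "\<And>n. d (p n) v = d u v - n"
    "\<And>n. d (p n) (p (Suc n)) \<le> 1"
proof -
  have "\<exists>p. \<forall>n. (p n \<in> carrier G \<and> d (p n) v = d u v - n \<and> (n = 0 \<longrightarrow> p n = u))
              \<and> d (p n) (p (Suc n)) \<le> 1"
  proof (intro dependent_nat_choice)
    fix x n assume x: "x \<in> carrier G \<and> d x v = d u v - n \<and> (n = 0 \<longrightarrow> x = u)"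
    show "\<exists>y. (y \<in> carrier G \<and> d y v = d u v - Suc n \<and> (Suc n = 0 \<longrightarrow> y = u)) \<and> d x y \<le> 1"
    proof -
      obtain y where "y \<in> carrier G" "d x y = min 1 (d x v)" "d y v = d x v - min 1 (d x v)"
        using d_between[of x v "min 1 (d x v)"] x v by auto
      then show ?thesis
        using x by (intro exI[of _ y]) auto
    qed
  qed (use u in auto)
  then show ?thesis
    using that by metis
qed

text \<open>Koenig's lemma: the balls are finite, so an infinite set of endpoints can be
  kept infinite at every step.\<close>
lemma infinite_geodesic_towards:
  assumes u: "u \<in> carrier G" and Y: "Y \<subseteq> carrier G" "infinite Y"
  obtains \<gamma> where "infinite_geodesic G D \<gamma>" "\<gamma> 0 = u"
    "\<And>n. infinite {y \<in> Y. n + d (\<gamma> n) y = d u y}"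
proof -
  let ?P = "\<lambda>n v. v \<in> carrier G \<and> d u v = n \<and> infinite {y \<in> Y. n + d v y = d u y}"
  have "\<exists>\<gamma>. \<forall>n. ?P n (\<gamma> n) \<and> d (\<gamma> n) (\<gamma> (Suc n)) \<le> 1"
  proof (intro dependent_nat_choice)
    show "\<exists>v. ?P 0 v"
      using u Y by (intro exI[of _ u]) simp
    fix v n assume v: "?P n v"
    let ?A = "{y \<in> Y. n + d v y = d u y}"
    let ?W = "{w \<in> carrier G. d v w \<le> 1}"
    \<comment> \<open>A geodesic from \<open>v\<close> to any other point of \<open>?A\<close>
      passes through \<open>?W\<close>, so an infinite set is covered by finitely many pieces, one
      of which is infinite.\<close>
    have "?A - {v} \<subseteq> (\<Union>w\<in>?W. {y \<in> Y. Suc n + d w y = d u y})"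
    proof
      fix y assume y: "y \<in> ?A - {v}"
      then have yc: "y \<in> carrier G" and y1: "1 \<le> d v y"
        using d_eq_0[of v y] v Y(1) by (auto simp: Suc_le_eq)
      then obtain w where w: "w \<in> carrier G" "d v w = 1" "d w y = d v y - 1"
        using d_between[of v y 1] v by blast
      then have "Suc n + d w y = d u y"
        using y y1 by simp
      then show "y \<in> (\<Union>w\<in>?W. {y \<in> Y. Suc n + d w y = d u y})"
        using y w by (intro UN_I[of w]) auto
    qed
    moreover have "infinite (?A - {v})"
      using v by simp
    ultimately have "infinite (\<Union>w\<in>?W. {y \<in> Y. Suc n + d w y = d u y})"
      by (rule infinite_super)
    then obtain w where w: "w \<in> ?W" "infinite {y \<in> Y. Suc n + d w y = d u y}"
      using finite_ball v by blast
    then obtain y where y: "y \<in> Y" "Suc n + d w y = d u y"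
      using not_finite_existsD by blast
    have "d u w = Suc n"
      using d_triangle[of u w y] d_triangle[of u v w] u v w(1) y Y by auto
    then show "\<exists>w. ?P (Suc n) w \<and> d v w \<le> 1"
      using w by blast
  qed
  then obtain \<gamma> where \<gamma>: "\<And>n. ?P n (\<gamma> n)" "\<And>n. d (\<gamma> n) (\<gamma> (Suc n)) \<le> 1"
    by blast
  have "\<gamma> 0 = u"
    using \<gamma>(1)[of 0] d_eq_0 u by auto
  then show ?thesis
    using \<gamma> by (intro that[of \<gamma>] infinite_geodesicI) auto
qed

text \<open>Convergence in the product topology, unfolded into coordinates; extensionality makes
  \<open>h\<close> a point of that space.\<close>

definition busemann_along :: "(nat \<Rightarrow> 'a) \<Rightarrow> ('a \<Rightarrow> real) \<Rightarrow> bool" where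
  "busemann_along \<gamma> h \<longleftrightarrow> infinite_geodesic G D \<gamma> \<and> h \<in> extensional (carrier G)
     \<and> (\<forall>y\<in>carrier G. (\<lambda>n. D (\<gamma> n) y - D (\<gamma> n) \<one>) \<longlonglongrightarrow> h y)"

lemma busemann_points_iff: "h \<in> busemann_points G D \<longleftrightarrow> (\<exists>\<gamma>. busemann_along \<gamma> h)"
  unfolding busemann_points_def busemann_along_def limitin_componentwise
  by (auto simp: metric_functional_def)

lemma busemann_alongD:
  assumes "busemann_along \<gamma> h"
  shows "infinite_geodesic G D \<gamma>" "\<And>n. \<gamma> n \<in> carrier G" "h \<in> extensional (carrier G)"
    "\<And>y. y \<in> carrier G \<Longrightarrow> (\<lambda>n. D (\<gamma> n) y - D (\<gamma> n) \<one>) \<longlonglongrightarrow> h y"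
  using assms infinite_geodesicD by (auto simp: busemann_along_def)

text \<open>For each \<open>y\<close> the sequence \<open>D (\<gamma> n) y - n\<close> decreases and
  is bounded below by \<open>- D (\<gamma> 0) y\<close>. The sequence in question is the difference
  of two such sequences.\<close>

lemma ex_busemann_along:
  assumes \<gamma>: "infinite_geodesic G D \<gamma>"
  obtains h where "busemann_along \<gamma> h"
proof -
  have conv: "convergent (\<lambda>n. D (\<gamma> n) y - real n)" if y: "y \<in> carrier G" for y
  proof -
    have dec: "decseq (\<lambda>n. D (\<gamma> n) y - real n)"
    proof (rule decseq_SucI)
      fix n
      have "d (\<gamma> (Suc n)) y \<le> d (\<gamma> n) y + 1"
        using d_triangle[of "\<gamma> (Suc n)" "\<gamma> n" y] infinite_geodesicD(2)[OF \<gamma>, of n "Suc n"]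
          d_sym infinite_geodesicD(1)[OF \<gamma>] y by fastforce
      then show "D (\<gamma> (Suc n)) y - real (Suc n) \<le> D (\<gamma> n) y - real n"
        by simp
    qed
    have "\<forall>n. - D (\<gamma> 0) y \<le> D (\<gamma> n) y - real n"
    proof
      fix n
      have "n \<le> d (\<gamma> 0) y + d (\<gamma> n) y"
        using d_triangle[of "\<gamma> 0" y "\<gamma> n"] infinite_geodesicD(2)[OF \<gamma>, of 0 n]
          d_sym infinite_geodesicD(1)[OF \<gamma>] y by fastforce
      then show "- D (\<gamma> 0) y \<le> D (\<gamma> n) y - real n"
        by linarith
    qed
    then show ?thesis
      using decseq_convergent[OF dec] convergentI by metis
  qed
  define h where "h = (\<lambda>y\<in>carrier G. lim (\<lambda>n. D (\<gamma> n) y - D (\<gamma> n) \<one>))"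
  have "(\<lambda>n. D (\<gamma> n) y - D (\<gamma> n) \<one>) \<longlonglongrightarrow> h y" if y: "y \<in> carrier G" for y
  proof -
    have "convergent (\<lambda>n. (D (\<gamma> n) y - real n) - (D (\<gamma> n) \<one> - real n))"
      by (rule convergent_diff[OF conv[OF y] conv[OF one_closed]])
    then show ?thesis
      using y by (simp add: h_def convergent_LIMSEQ_iff)
  qed
  then show ?thesis
    using \<gamma> that[of h] by (auto simp: busemann_along_def h_def)
qed

text \<open>For \<open>m \<ge> n\<close> the distances from \<open>\<gamma> m\<close> to
  \<open>\<gamma> n\<close> and to \<open>\<gamma> 0\<close> are \<open>m - n\<close> and
  \<open>m\<close>, so the difference is constant in \<open>m\<close>.\<close>

lemma busemann_along_geodesic:
  assumes h: "busemann_along \<gamma> h"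
  shows "h (\<gamma> n) = h (\<gamma> 0) - real n"
proof -
  note \<gamma> = busemann_alongD[OF h]
  have "(\<lambda>m. (D (\<gamma> m) (\<gamma> n) - D (\<gamma> m) \<one>) - (D (\<gamma> m) (\<gamma> 0) - D (\<gamma> m) \<one>)) \<longlonglongrightarrow> h (\<gamma> n) - h (\<gamma> 0)"
    by (intro tendsto_diff[OF \<gamma>(4) \<gamma>(4)] \<gamma>(2))
  moreover have "\<forall>\<^sub>F m in sequentially.
      (D (\<gamma> m) (\<gamma> n) - D (\<gamma> m) \<one>) - (D (\<gamma> m) (\<gamma> 0) - D (\<gamma> m) \<one>) = - real n"
    using eventually_ge_at_top[of n]
  proof eventually_elim
    case (elim m)
    then show ?case
      using infinite_geodesicD(2)[OF \<gamma>(1), of n m] infinite_geodesicD(2)[OF \<gamma>(1), of 0 m]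
        d_sym[OF \<gamma>(2) \<gamma>(2), of m] by simp
  qed
  ultimately have "(\<lambda>m. - real n) \<longlonglongrightarrow> h (\<gamma> n) - h (\<gamma> 0)"
    by (simp add: tendsto_cong)
  then show ?thesis
    by (simp add: LIMSEQ_const_iff)
qed

text \<open>The hypothesis means that the ray prolongs a geodesic from \<one> to
  \<open>\<gamma> 0\<close>, which makes the defining sequence constant at
  \<open>\<gamma> 0\<close>.\<close>

lemma busemann_along_start:
  assumes h: "busemann_along \<gamma> h" and "\<And>n. d \<one> (\<gamma> n) = r + n"
  shows "h (\<gamma> 0) = - real r"
proof -
  note \<gamma> = busemann_alongD[OF h]
  have "D (\<gamma> n) (\<gamma> 0) - D (\<gamma> n) \<one> = - real r" for n
    using infinite_geodesicD(2)[OF \<gamma>(1), of 0 n] d_sym[OF \<gamma>(2) \<gamma>(2), of n 0]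
      d_sym[OF \<gamma>(2) one_closed, of n] assms(2)[of n] by simp
  then show ?thesis
    using \<gamma>(4)[OF \<gamma>(2), of 0] by (simp add: LIMSEQ_const_iff)
qed

lemma busemann_one:
  assumes "h \<in> busemann_points G D"
  shows "h \<one> = 0"
  using assms by (force simp: busemann_points_iff LIMSEQ_const_iff dest: busemann_alongD(4))

lemma busemann_lipschitz:
  assumes "h \<in> busemann_points G D" and y: "y \<in> carrier G" and z: "z \<in> carrier G"
  shows "\<bar>h y - h z\<bar> \<le> D y z"
proof -
  obtain \<gamma> where \<gamma>: "busemann_along \<gamma> h"
    using assms(1) busemann_points_iff by blast
  have "(\<lambda>n. \<bar>(D (\<gamma> n) y - D (\<gamma> n) \<one>) - (D (\<gamma> n) z - D (\<gamma> n) \<one>)\<bar>) \<longlonglongrightarrow> \<bar>h y - h z\<bar>"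
    by (intro tendsto_rabs tendsto_diff[OF busemann_alongD(4)[OF \<gamma>] busemann_alongD(4)[OF \<gamma>]] y z)
  moreover have "\<bar>(D (\<gamma> n) y - D (\<gamma> n) \<one>) - (D (\<gamma> n) z - D (\<gamma> n) \<one>)\<bar> \<le> D y z" for n
    using D_diff_le[OF busemann_alongD(2)[OF \<gamma>] y z, of n] by simp
  ultimately show ?thesis
    by (intro LIMSEQ_le_const2) auto
qed

text \<open>This is the Busemann point of the ray \<open>inv a \<otimes> \<gamma> n\<close>;
  subtracting \<open>h a\<close> restores the value 0 at \<one>.\<close>

lemma busemann_translate:
  assumes h: "h \<in> busemann_points G D" and a: "a \<in> carrier G"
  shows "(\<lambda>y\<in>carrier G. h (a \<otimes> y) - h a) \<in> busemann_points G D"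
proof -
  obtain \<gamma> where h: "busemann_along \<gamma> h"
    using assms(1) busemann_points_iff by blast
  note \<gamma> = busemann_alongD[OF h]
  have D: "D (inv a \<otimes> \<gamma> n) y = D (\<gamma> n) (a \<otimes> y)" if "y \<in> carrier G" for n y
    using d_left_mult[of a "inv a \<otimes> \<gamma> n" y] that a \<gamma>(2) by (simp flip: m_assoc)
  have "infinite_geodesic G D (\<lambda>n. inv a \<otimes> \<gamma> n)"
    using \<gamma>(1,2) a by (auto simp: infinite_geodesic_def d_left_mult)
  moreover have "(\<lambda>n. D (inv a \<otimes> \<gamma> n) y - D (inv a \<otimes> \<gamma> n) \<one>) \<longlonglongrightarrow> h (a \<otimes> y) - h a"
    if y: "y \<in> carrier G" for y
  proof -
    have "(\<lambda>n. (D (\<gamma> n) (a \<otimes> y) - D (\<gamma> n) \<one>) - (D (\<gamma> n) a - D (\<gamma> n) \<one>)) \<longlonglongrightarrow> h (a \<otimes> y) - h a"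
      by (intro tendsto_diff[OF \<gamma>(4) \<gamma>(4)] m_closed a y)
    then show ?thesis
      using y a by (simp add: D)
  qed
  ultimately have "busemann_along (\<lambda>n. inv a \<otimes> \<gamma> n) (\<lambda>y\<in>carrier G. h (a \<otimes> y) - h a)"
    by (auto simp: busemann_along_def)
  then show ?thesis
    using busemann_points_iff by blast
qed

lemma busemann_points_subset_boundary:
  "busemann_points G D \<subseteq> metric_functional_boundary G D"
proof
  fix h assume "h \<in> busemann_points G D"
  then obtain \<gamma> where \<gamma>: "busemann_along \<gamma> h"
    "limitin (powertop_real (carrier G)) (\<lambda>n. metric_functional G D (\<gamma> n)) h sequentially"
    unfolding busemann_points_def busemann_along_def limitin_componentwise
    by (auto simp: metric_functional_def)
  have c: "\<gamma> n \<in> carrier G" for n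
    using busemann_alongD(2)[OF \<gamma>(1)] .
  have "h \<in> powertop_real (carrier G) closure_of (metric_functional G D ` carrier G)"
    unfolding in_closure_of
  proof (intro conjI allI impI)
    show "h \<in> topspace (powertop_real (carrier G))"
      using \<gamma>(2) by (rule limitin_topspace)
    fix T assume "h \<in> T \<and> openin (powertop_real (carrier G)) T"
    then have "\<forall>\<^sub>F n in sequentially. metric_functional G D (\<gamma> n) \<in> T"
      using \<gamma>(2) by (simp add: limitin_def)
    then show "\<exists>y. y \<in> metric_functional G D ` carrier G \<and> y \<in> T"
      using c eventually_happens' sequentially_bot by blast
  qed
  \<comment> \<open>A metric functional at \<open>x\<close> is bounded below by
    \<open>- D x \<one>\<close>, whereas \<open>h\<close> tends to minus infinity along its
    ray.\<close>
  moreover have "h \<notin> metric_functional G D ` carrier G"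
  proof
    assume "h \<in> metric_functional G D ` carrier G"
    then obtain x where x: "h = metric_functional G D x"
      by blast
    obtain n where "h (\<gamma> 0) + D x \<one> < real n"
      using reals_Archimedean2 by blast
    then have "h (\<gamma> n) < - D x \<one>"
      using busemann_along_geodesic[OF \<gamma>(1), of n] by linarith
    then show False
      using c by (simp add: x metric_functional_def)
  qed
  ultimately show "h \<in> metric_functional_boundary G D"
    by (simp add: metric_functional_boundary_def)
qed

section \<open>The boundary of a virtually cyclic group\<close>

lemma boundary_extensional:
  assumes "h \<in> metric_functional_boundary G D"
  shows "h \<in> extensional (carrier G)"
  using assms closure_of_subset_topspace[of "powertop_real (carrier G)"]
  by (fastforce simp: metric_functional_boundary_def PiE_def)

text \<open>Metric functionals take integer values, evaluation at \<open>y\<close> is continuous,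
  and the integers form a closed set.\<close>

lemma boundary_Ints:
  assumes h: "h \<in> metric_functional_boundary G D" and y: "y \<in> carrier G"
  shows "h y \<in> \<int>"
proof -
  have "continuous_map (powertop_real (carrier G)) euclideanreal (\<lambda>f. f y)"
    using y by (rule continuous_map_product_projection)
  then have "h y \<in> euclideanreal closure_of ((\<lambda>f. f y) ` metric_functional G D ` carrier G)"
    using continuous_map_image_closure_subset h unfolding metric_functional_boundary_def by blast
  moreover have "(\<lambda>f. f y) ` metric_functional G D ` carrier G \<subseteq> \<int>"
    using y by (auto simp: metric_functional_def)
  moreover have "closedin euclideanreal (\<int> :: real set)"
    by (simp add: closed_Ints)
  ultimately show ?thesis
    using closure_of_minimal by blast
qed

text \<open>Since all values are integers, a neighbourhood of radius 1 on finitely many coordinates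
  already forces equality there.\<close>

lemma boundary_approx:
  assumes h: "h \<in> metric_functional_boundary G D"
    and W: "finite W" "W \<subseteq> carrier G" and E: "finite E"
  obtains z where "z \<in> carrier G - E" "\<And>w. w \<in> W \<Longrightarrow> h w = D z w - D z \<one>"
proof -
  \<comment> \<open>A boundary point differs somewhere from each metric functional. Adding such a
    place to the window for every \<open>e\<close> in \<open>E\<close> keeps the approximating point
    out of \<open>E\<close>.\<close>
  have "\<exists>y\<in>carrier G. h y \<noteq> metric_functional G D e y" if "e \<in> E \<inter> carrier G" for e
  proof (rule ccontr)
    assume "\<not> ?thesis"
    then have "h = metric_functional G D e"
      using boundary_extensional[OF h]
      by (intro extensionalityI[of _ "carrier G"]) (auto simp: metric_functional_def)
    then show False
      using h that by (auto simp: metric_functional_boundary_def)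
  qed
  then obtain y where y: "\<And>e. e \<in> E \<inter> carrier G \<Longrightarrow> y e \<in> carrier G"
      "\<And>e. e \<in> E \<inter> carrier G \<Longrightarrow> h (y e) \<noteq> metric_functional G D e (y e)"
    by metis
  define V where "V = W \<union> y ` (E \<inter> carrier G)"
  have V: "finite V" "V \<subseteq> carrier G"
    using W E y(1) by (auto simp: V_def)
  let ?T = "PiE (carrier G) (\<lambda>i. if i \<in> V then ball (h i) 1 else UNIV)"
  have "finite {i \<in> carrier G. (if i \<in> V then ball (h i) 1 else UNIV) \<noteq> topspace euclideanreal}"
    by (rule finite_subset[OF _ V(1)]) auto
  then have "openin (powertop_real (carrier G)) ?T"
    unfolding openin_PiE_gen by (intro disjI2 conjI) auto
  moreover have "h \<in> ?T"
    using boundary_extensional[OF h] by (auto simp: PiE_iff)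
  moreover have "h \<in> powertop_real (carrier G) closure_of (metric_functional G D ` carrier G)"
    using h by (simp add: metric_functional_boundary_def)
  ultimately have "\<exists>g. g \<in> metric_functional G D ` carrier G \<and> g \<in> ?T"
    unfolding in_closure_of by blast
  then obtain z where z: "z \<in> carrier G" "metric_functional G D z \<in> ?T"
    by blast
  have eq: "h v = metric_functional G D z v" if "v \<in> V" for v
  proof -
    have v: "v \<in> carrier G"
      using that V(2) by blast
    then have "metric_functional G D z v \<in> \<int>"
      by (simp add: metric_functional_def)
    moreover have "\<bar>h v - metric_functional G D z v\<bar> < 1"
      using PiE_mem[OF z(2) v] that by (simp add: dist_real_def)
    ultimately show ?thesis
      using boundary_Ints[OF h v] Ints_eq_abs_less1 by blast
  qed
  show ?thesis
  proof (rule that[of z])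
    show "z \<in> carrier G - E"
      using z(1) y(2)[of z] eq[of "y z"] by (auto simp: V_def)
    show "h w = D z w - D z \<one>" if "w \<in> W" for w
      using that eq[of w] W(2) by (auto simp: V_def metric_functional_def)
  qed
qed

lemma boundary_lipschitz:
  assumes h: "h \<in> metric_functional_boundary G D" and "y \<in> carrier G" "z \<in> carrier G"
  shows "\<bar>h y - h z\<bar> \<le> D y z"
proof -
  obtain x where x: "x \<in> carrier G - {}" "\<And>w. w \<in> {y, z} \<Longrightarrow> h w = D x w - D x \<one>"
    using boundary_approx[OF h, of "{y, z}" "{}"] assms by auto
  then show ?thesis
    using D_diff_le[of x y z] assms x(2)[of y] x(2)[of z] by auto
qed

text \<open>Only one geodesic from \<open>z\<close> to each \<open>w\<close> has to meet
  \<open>C\<close>, not all of them.\<close>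

definition separates :: "'a set \<Rightarrow> 'a \<Rightarrow> 'a set \<Rightarrow> bool" where
  "separates C z W \<longleftrightarrow> (\<forall>w\<in>W. \<exists>x\<in>C. d z w = d z x + d x w)"

text \<open>Suppose any finite window is separated from almost all of the group by one of two translates
  of a fixed finite set. Then a boundary point is determined on the window by its restriction to
  one of the two translates, and up to a constant there are boundedly many such restrictions.\<close>
lemma finite_boundary_of_cuts:
  assumes C: "finite C" "C \<subseteq> carrier G" and c: "c \<in> C"
    and cuts: "\<And>W. finite W \<Longrightarrow> W \<subseteq> carrier G \<Longrightarrow>
      \<exists>a b E. a \<in> carrier G \<and> b \<in> carrier G \<and> finite E \<and>
        (\<forall>z\<in>carrier G - E. \<exists>e\<in>{a, b}. separates ((\<otimes>) e ` C) z W)"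
  shows "finite (metric_functional_boundary G D)"
proof (rule ccontr)
  assume inf: "infinite (metric_functional_boundary G D)"
  \<comment> \<open>Normalized at \<open>c\<close>, the restrictions to any translate of
    \<open>C\<close> are integer-valued and bounded by the Lipschitz condition. By left invariance
    one finite set serves all translates.\<close>
  define profiles where "profiles = PiE C (\<lambda>x. {t\<in>\<int>. \<bar>t\<bar> \<le> D c x})"
  define profile where "profile a h = (\<lambda>x\<in>C. h (a \<otimes> x) - h (a \<otimes> c))" for a and h :: "'a \<Rightarrow> real"
  have "finite profiles"
    using C(1) finite_abs_int_segment by (auto simp: profiles_def intro!: finite_PiE)
  \<comment> \<open>One more element than there are pairs of a translate, out of two, and a
    profile.\<close>
  obtain F where F: "F \<subseteq> metric_functional_boundary G D" "finite F" "card F = Suc (2 * card profiles)"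
    using infinite_arbitrarily_large[OF inf] by blast
  have ext: "\<exists>y\<in>carrier G. h y \<noteq> k y" if "h \<in> F" "k \<in> F" "h \<noteq> k" for h k
    using that F(1) boundary_extensional by (meson extensionalityI subset_iff)
  then obtain y where y: "\<And>h k. \<lbrakk>h \<in> F; k \<in> F; h \<noteq> k\<rbrakk> \<Longrightarrow> y h k \<in> carrier G"
      "\<And>h k. \<lbrakk>h \<in> F; k \<in> F; h \<noteq> k\<rbrakk> \<Longrightarrow> h (y h k) \<noteq> k (y h k)"
    by metis
  \<comment> \<open>The window tells any two members of \<open>F\<close> apart, and \<one> is
    included to fix the additive constants.\<close>
  define W where "W = insert \<one> ((\<lambda>(h, k). y h k) ` {(h, k). h \<in> F \<and> k \<in> F \<and> h \<noteq> k})"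
  have "finite {(h, k). h \<in> F \<and> k \<in> F \<and> h \<noteq> k}"
    by (rule finite_subset[of _ "F \<times> F"]) (use F(2) in auto)
  then have W: "finite W" "W \<subseteq> carrier G" "\<one> \<in> W"
    using y(1) by (auto simp: W_def)
  obtain a b E where ab: "a \<in> carrier G" "b \<in> carrier G" "finite E"
    and cut: "\<And>z. z \<in> carrier G - E \<Longrightarrow> \<exists>e\<in>{a, b}. separates ((\<otimes>) e ` C) z W"
    using cuts[OF W(1,2)] by metis
  have "\<exists>e\<in>{a, b}. \<forall>w\<in>W. \<exists>x\<in>C. h w = h (e \<otimes> x) + D (e \<otimes> x) w" if h: "h \<in> F" for h
  proof -
    let ?V = "W \<union> (\<otimes>) a ` C \<union> (\<otimes>) b ` C"
    have hb: "h \<in> metric_functional_boundary G D"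
      using h F(1) by blast
    have V: "finite ?V" "?V \<subseteq> carrier G"
      using W C ab by auto
    obtain z where z: "z \<in> carrier G - E" "\<And>w. w \<in> ?V \<Longrightarrow> h w = D z w - D z \<one>"
      using boundary_approx[OF hb V ab(3)] by blast
    obtain e where e: "e \<in> {a, b}" "separates ((\<otimes>) e ` C) z W"
      using cut[OF z(1)] by blast
    have "\<exists>x\<in>C. h w = h (e \<otimes> x) + D (e \<otimes> x) w" if w: "w \<in> W" for w
    proof -
      obtain x where x: "x \<in> C" "d z w = d z (e \<otimes> x) + d (e \<otimes> x) w"
        using e(2) w by (auto simp: separates_def)
      have "h w = D z w - D z \<one>" "h (e \<otimes> x) = D z (e \<otimes> x) - D z \<one>"
        using z(2) w x(1) e(1) by blast+
      then show ?thesis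
        using x by (intro bexI[of _ x]) auto
    qed
    then show ?thesis
      using e(1) by blast
  qed
  then obtain e where e: "\<And>h. h \<in> F \<Longrightarrow> e h \<in> {a, b}"
      "\<And>h w. h \<in> F \<Longrightarrow> w \<in> W \<Longrightarrow> \<exists>x\<in>C. h w = h (e h \<otimes> x) + D (e h \<otimes> x) w"
    by metis
  have profile: "profile a' h \<in> profiles" if h: "h \<in> F" and a': "a' \<in> carrier G" for h a'
  proof -
    have hb: "h \<in> metric_functional_boundary G D"
      using h F(1) by blast
    have "h (a' \<otimes> x) - h (a' \<otimes> c) \<in> \<int> \<and> \<bar>h (a' \<otimes> x) - h (a' \<otimes> c)\<bar> \<le> D c x" if "x \<in> C" for x
    proof
      have xc: "x \<in> carrier G" "c \<in> carrier G"
        using that C(2) c by auto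
      show "h (a' \<otimes> x) - h (a' \<otimes> c) \<in> \<int>"
        using boundary_Ints[OF hb] xc a' by simp
      show "\<bar>h (a' \<otimes> x) - h (a' \<otimes> c)\<bar> \<le> D c x"
        using boundary_lipschitz[OF hb, of "a' \<otimes> x" "a' \<otimes> c"] xc a' d_left_mult d_sym by simp
    qed
    then show ?thesis
      by (auto simp: profile_def profiles_def)
  qed
  let ?g = "\<lambda>h. (e h, profile (e h) h)"
  have "?g ` F \<subseteq> {a, b} \<times> profiles"
    using e(1) profile ab by fastforce
  then have "card (?g ` F) \<le> card ({a, b} \<times> profiles)"
    using \<open>finite profiles\<close> by (intro card_mono) auto
  also have "\<dots> \<le> 2 * card profiles"
    by (simp add: card_cartesian_product card_insert_if)
  finally have "\<not> inj_on ?g F"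
    using F(3) card_image by fastforce
  then obtain h k where "h \<in> F" "k \<in> F" "h \<noteq> k" "?g h = ?g k"
    unfolding inj_on_def by blast
  then have hk: "h \<in> F" "k \<in> F" "h \<noteq> k" "e h = e k" "profile (e h) h = profile (e h) k"
    by auto
  have prof: "h (e h \<otimes> x) - h (e h \<otimes> c) = k (e h \<otimes> x) - k (e h \<otimes> c)" if "x \<in> C" for x
    using fun_cong[OF hk(5), of x] that by (simp add: profile_def)
  have ec: "e h \<in> carrier G"
    using e(1)[OF hk(1)] ab by auto
  \<comment> \<open>At a point \<open>x\<close> of the cut, \<open>h1 w\<close> equals its largest
    Lipschitz value, while \<open>h2 w\<close> is at most its own such value. Exchanging the two
    functions gives equality on \<open>W\<close> up to a constant.\<close>
  have le: "h1 w - h1 (e h \<otimes> c) \<ge> h2 w - h2 (e h \<otimes> c)"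
    if "h1 \<in> {h, k}" "h2 \<in> {h, k}" "w \<in> W" for h1 h2 w
  proof -
    have "h1 \<in> F" "e h1 = e h"
      using that hk by auto
    then obtain x where x: "x \<in> C" "h1 w = h1 (e h \<otimes> x) + D (e h \<otimes> x) w"
      using e(2)[of h1 w] \<open>w \<in> W\<close> by metis
    have "h1 (e h \<otimes> x) - h1 (e h \<otimes> c) = h2 (e h \<otimes> x) - h2 (e h \<otimes> c)"
      using prof[OF x(1)] that by auto
    moreover have "\<bar>h2 (e h \<otimes> x) - h2 w\<bar> \<le> D (e h \<otimes> x) w"
      using that hk F(1) C(2) x(1) W(2) ec by (intro boundary_lipschitz) auto
    ultimately show ?thesis
      using x(2) by linarith
  qed
  have one: "h \<one> = 0" if h: "h \<in> F" for h
  proof -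
    have "h \<in> metric_functional_boundary G D"
      using h F(1) by blast
    from boundary_approx[OF this, of "{\<one>}" "{}"] show ?thesis
      by auto
  qed
  have "h (e h \<otimes> c) = k (e h \<otimes> c)"
    using le[of h k \<one>] le[of k h \<one>] W(3) one[OF hk(1)] one[OF hk(2)] by simp
  moreover have "y h k \<in> W"
    using hk by (auto simp: W_def)
  ultimately have "h (y h k) = k (y h k)"
    using le[of h k "y h k"] le[of k h "y h k"] by auto
  then show False
    using y(2) hk by blast
qed

end

section \<open>Height functions on virtually cyclic groups\<close>

lemma int_crossing:
  fixes g :: "nat \<Rightarrow> int"
  assumes "\<And>i. \<bar>g (Suc i) - g i\<bar> \<le> L" "a \<le> g 0" "g n < a + L"
  shows "\<exists>i\<le>n. a \<le> g i \<and> g i < a + L"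
proof -
  \<comment> \<open>Just before the first index below \<open>a + L\<close> the value is at least
    \<open>a + L\<close>, and one step loses at most \<open>L\<close>.\<close>
  define i where "i = (LEAST i. g i < a + L)"
  have i: "g i < a + L"
    unfolding i_def using assms(3) by (rule LeastI)
  have "a \<le> g i"
  proof (cases i)
    case (Suc j)
    then have "\<not> g j < a + L"
      unfolding i_def by (metis lessI not_less_Least)
    then show ?thesis
      using assms(1)[of j] by (simp add: Suc)
  qed (use assms in auto)
  moreover have "i \<le> n"
    unfolding i_def using assms(3) by (rule Least_le)
  ultimately show ?thesis
    using i by blast
qed

text \<open>\<open>\<xi>\<close> inverts an isomorphism from a finite-index subgroup
  \<open>H\<close> to the integers. Write \<open>y\<close> as an element of \<open>H\<close> times
  the chosen representative of its right coset: \<open>f y\<close> is the integer of the first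
  factor, and \<open>T\<close> collects the representatives.\<close>

lemma (in group) virtually_Z_height:
  assumes "virtually_Z G"
  obtains f :: "'a \<Rightarrow> int" and \<xi> T where
    "\<And>k. \<xi> k \<in> carrier G" "\<And>k y. y \<in> carrier G \<Longrightarrow> f (\<xi> k \<otimes> y) = k + f y"
    "finite T" "T \<subseteq> carrier G" "\<And>y. y \<in> carrier G \<Longrightarrow> \<exists>t\<in>T. y = \<xi> (f y) \<otimes> t"
proof -
  obtain H \<phi> where H: "subgroup H G" "finite (rcosets H)"
    and \<phi>: "\<phi> \<in> iso (G\<lparr>carrier := H\<rparr>) integer_group"
    using assms unfolding virtually_Z_def is_iso_def by blast
  have \<phi>_mult: "\<phi> (x \<otimes> y) = \<phi> x + \<phi> y" if "x \<in> H" "y \<in> H" for x y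
    using \<phi> that by (auto simp: iso_def hom_def)
  have \<phi>_bij: "bij_betw \<phi> H UNIV"
    using \<phi> by (simp add: iso_def)
  have Hc: "x \<in> carrier G" if "x \<in> H" for x
    by (rule subgroup.mem_carrier[OF H(1) that])
  have HG: "H \<subseteq> carrier G"
    using Hc by blast
  define \<xi> where "\<xi> = the_inv_into H \<phi>"
  have \<xi>: "\<xi> k \<in> H" "\<phi> (\<xi> k) = k" for k
    using bij_betwE[OF bij_betw_the_inv_into[OF \<phi>_bij]] f_the_inv_into_f_bij_betw[OF \<phi>_bij]
    by (simp_all add: \<xi>_def)
  have \<phi>_inv: "\<xi> (\<phi> x) = x" if "x \<in> H" for x
    unfolding \<xi>_def using \<phi>_bij that by (simp add: bij_betw_def the_inv_into_f_f)
  define rep where "rep R = (SOME x. x \<in> R)" for R :: "'a set"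
  have rep: "rep (H #> y) \<in> carrier G" "y \<otimes> inv rep (H #> y) \<in> H" "H #> rep (H #> y) = H #> y"
    if y: "y \<in> carrier G" for y
  proof -
    have "y \<in> H #> y"
      using rcos_self[OF y H(1)] .
    then have r: "rep (H #> y) \<in> H #> y"
      unfolding rep_def by (rule someI)
    then show rc: "rep (H #> y) \<in> carrier G"
      using r_coset_subset_G[OF HG y] by blast
    show eq: "H #> rep (H #> y) = H #> y"
      using repr_independence[OF r y H(1)] by simp
    then have "y \<in> H #> rep (H #> y)"
      using \<open>y \<in> H #> y\<close> by simp
    then obtain x where x: "x \<in> H" "x \<otimes> rep (H #> y) = y"
      by (auto simp: r_coset_def)
    then have "x = y \<otimes> inv rep (H #> y)"
      using y rc Hc by (intro inv_solve_right[THEN iffD2]) auto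
    then show "y \<otimes> inv rep (H #> y) \<in> H"
      using x(1) by simp
  qed
  define f where "f y = \<phi> (y \<otimes> inv rep (H #> y))" for y
  show ?thesis
  proof (rule that[of \<xi> f "rep ` (rcosets H)"])
    show "\<xi> k \<in> carrier G" for k
      using \<xi> Hc by blast
    show "f (\<xi> k \<otimes> y) = k + f y" if y: "y \<in> carrier G" for k y
    proof -
      have "H #> (\<xi> k \<otimes> y) = H #> y"
        using coset_mult_assoc[OF HG Hc[OF \<xi>(1)] y] coset_join2[OF Hc[OF \<xi>(1)] H(1) \<xi>(1)]
        by simp
      then have "f (\<xi> k \<otimes> y) = \<phi> (\<xi> k \<otimes> (y \<otimes> inv rep (H #> y)))"
        using y \<xi>(1) Hc rep(1)[OF y] by (simp add: f_def m_assoc)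
      then show ?thesis
        using rep(2)[OF y] \<xi> by (simp add: f_def \<phi>_mult)
    qed
    show "finite (rep ` (rcosets H))"
      using H(2) by simp
    show "rep ` (rcosets H) \<subseteq> carrier G"
      using rep(1) by (auto simp: RCOSETS_def)
    show "\<exists>t\<in>rep ` (rcosets H). y = \<xi> (f y) \<otimes> t" if y: "y \<in> carrier G" for y
    proof
      show "rep (H #> y) \<in> rep ` (rcosets H)"
        using y by (auto simp: RCOSETS_def)
      show "y = \<xi> (f y) \<otimes> rep (H #> y)"
        using rep[OF y] y by (simp add: f_def \<phi>_inv m_assoc)
    qed
  qed
qed

context geodesic_group_metric
begin

lemma virtually_Z_finite_boundary:
  assumes "virtually_Z G"
  shows "finite (metric_functional_boundary G D)"
proof -
  obtain f :: "'a \<Rightarrow> int" and \<xi> T where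
    \<xi>: "\<And>k. \<xi> k \<in> carrier G" and f_mult: "\<And>k y. y \<in> carrier G \<Longrightarrow> f (\<xi> k \<otimes> y) = k + f y"
    and T: "finite T" "T \<subseteq> carrier G" and cover: "\<And>y. y \<in> carrier G \<Longrightarrow> \<exists>t\<in>T. y = \<xi> (f y) \<otimes> t"
    using virtually_Z_height[OF assms] by metis
  have level: "finite {y \<in> carrier G. a \<le> f y \<and> f y \<le> b}" for a b
  proof (rule finite_subset)
    show "{y \<in> carrier G. a \<le> f y \<and> f y \<le> b} \<subseteq> (\<lambda>(k, t). \<xi> k \<otimes> t) ` ({a..b} \<times> T)"
    proof clarify
      fix y assume y: "y \<in> carrier G" "a \<le> f y" "f y \<le> b"
      then obtain t where "t \<in> T" "y = \<xi> (f y) \<otimes> t"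
        using cover by blast
      then show "y \<in> (\<lambda>(k, t). \<xi> k \<otimes> t) ` ({a..b} \<times> T)"
        using y by (intro image_eqI[of _ _ "(f y, t)"]) auto
    qed
  qed (use T in auto)
  \<comment> \<open>A bound for \<open>f\<close> near \<open>T\<close> bounds the change of height
    along every edge, because translating by \<open>inv \<xi> (f y)\<close> moves \<open>y\<close>
    into \<open>T\<close> and shifts all heights equally.\<close>
  let ?N = "\<Union>t\<in>T. {y \<in> carrier G. d t y \<le> 1}"
  have "finite ?N"
    using T finite_ball by auto
  then have "bdd_above ((\<lambda>y. \<bar>f y\<bar>) ` ?N)"
    by simp
  then obtain L0 where "\<forall>k\<in>(\<lambda>y. \<bar>f y\<bar>) ` ?N. k \<le> L0"
    unfolding bdd_above_def ..
  then have L0: "\<And>t y. \<lbrakk>t \<in> T; y \<in> carrier G; d t y \<le> 1\<rbrakk> \<Longrightarrow> \<bar>f y\<bar> \<le> L0"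
    by blast
  \<comment> \<open>With \<open>L \<ge> 1\<close> the slab \<open>C\<close> below contains a point
    of height 0.\<close>
  define L where "L = max 1 L0"
  have step: "\<bar>f z - f y\<bar> \<le> L" if yz: "y \<in> carrier G" "z \<in> carrier G" "d y z \<le> 1" for y z
  proof -
    obtain t where t: "t \<in> T" "y = \<xi> (f y) \<otimes> t"
      using cover[OF yz(1)] by blast
    define z' where "z' = inv \<xi> (f y) \<otimes> z"
    have z': "z' \<in> carrier G" "z = \<xi> (f y) \<otimes> z'"
      using \<xi> yz by (auto simp: z'_def simp flip: m_assoc)
    have "d t z' = d y z"
      using d_left_mult[OF \<xi>[of "f y"], of t z'] t T z' by auto
    then have "\<bar>f z'\<bar> \<le> L"
      using L0[OF t(1) z'(1)] yz(3) by (auto simp: L_def)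
    moreover have "f z = f y + f z'"
      using f_mult z' by metis
    ultimately show ?thesis
      by simp
  qed
  define C where "C = {y \<in> carrier G. 0 \<le> f y \<and> f y < L}"
  have cross: "\<exists>c\<in>C. d u v = d u (\<xi> a \<otimes> c) + d (\<xi> a \<otimes> c) v"
    if uv: "u \<in> carrier G" "v \<in> carrier G" "a \<le> f u" "f v < a + L" for u v a
  proof -
    obtain p where p: "p 0 = u" "\<And>n. p n \<in> carrier G" "\<And>n. d (p n) v = d u v - n"
      "\<And>n. d (p n) (p (Suc n)) \<le> 1"
      using geodesic_segment[OF uv(1,2)] by blast
    have "p (d u v) = v"
      using p(2,3)[of "d u v"] d_eq_0 uv(2) by simp
    then obtain i where i: "i \<le> d u v" "a \<le> f (p i)" "f (p i) < a + L"
      using int_crossing[of "\<lambda>i. f (p i)" L a "d u v"] step[OF p(2) p(2) p(4)] p(1) uv by auto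
    define c where "c = inv \<xi> a \<otimes> p i"
    have c: "c \<in> carrier G" "\<xi> a \<otimes> c = p i"
      using \<xi> p(2) by (auto simp: c_def simp flip: m_assoc)
    have "c \<in> C"
      using f_mult[OF c(1), of a] i c by (simp add: C_def)
    moreover have "d u v = d u (p i) + d (p i) v"
    proof -
      have "d u (p i) \<le> i"
        using d_le_of_steps[of p 0 i, OF p(2,4)] p(1) by simp
      then show ?thesis
        using d_triangle[OF uv(1) p(2) uv(2), of i] p(3)[of i] i(1) by linarith
    qed
    ultimately show ?thesis
      using c(2) by (intro bexI[of _ c]) simp_all
  qed
  show ?thesis
  proof (rule finite_boundary_of_cuts[of C "\<xi> (- f \<one>)"])
    have "C \<subseteq> {y \<in> carrier G. 0 \<le> f y \<and> f y \<le> L}"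
      by (auto simp: C_def)
    then show "finite C"
      using level finite_subset by blast
    show "C \<subseteq> carrier G"
      by (auto simp: C_def)
    have "f (\<xi> (- f \<one>)) = 0"
      using f_mult[OF one_closed, of "- f \<one>"] \<xi> by simp
    then show "\<xi> (- f \<one>) \<in> C"
      using \<xi> by (simp add: C_def L_def)
  next
    fix W assume W: "finite W" "W \<subseteq> carrier G"
    then have "bdd_above ((\<lambda>y. \<bar>f y\<bar>) ` W)"
      by simp
    then obtain m where "\<forall>k\<in>(\<lambda>y. \<bar>f y\<bar>) ` W. k \<le> m"
      unfolding bdd_above_def ..
    then have m: "\<And>w. w \<in> W \<Longrightarrow> \<bar>f w\<bar> \<le> m"
      by blast
    let ?E = "{y \<in> carrier G. - m \<le> f y \<and> f y \<le> m}"
    \<comment> \<open>Points higher than \<open>m\<close> are cut off by the slab starting at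
      \<open>m\<close>, points lower than \<open>- m\<close> by the slab just below
      \<open>- m\<close>. In the second case the geodesic runs from \<open>w\<close> to
      \<open>z\<close>, since \<open>cross\<close> goes downwards.\<close>
    have "\<exists>e\<in>{\<xi> m, \<xi> (- m - L)}. separates ((\<otimes>) e ` C) z W"
      if z: "z \<in> carrier G - ?E" for z
    proof (cases "m < f z")
      case True
      have "\<exists>x\<in>C. d z w = d z (\<xi> m \<otimes> x) + d (\<xi> m \<otimes> x) w" if w: "w \<in> W" for w
        using cross[of z w m] z True W w m[OF w] by (auto simp: L_def)
      then have "separates ((\<otimes>) (\<xi> m) ` C) z W"
        by (simp add: separates_def)
      then show ?thesis by blast
    next
      case False
      have "\<exists>x\<in>C. d z w = d z (\<xi> (- m - L) \<otimes> x) + d (\<xi> (- m - L) \<otimes> x) w" if w: "w \<in> W" for w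
      proof -
        have wc: "w \<in> carrier G" and zc: "z \<in> carrier G"
          using w W z by auto
        have "1 \<le> L"
          by (simp add: L_def)
        then have "- m - L \<le> f w" "f z < - m - L + L"
          using z zc False m[OF w] by auto
        then obtain x where x: "x \<in> C" "d w z = d w (\<xi> (- m - L) \<otimes> x) + d (\<xi> (- m - L) \<otimes> x) z"
          using cross[OF wc zc] by blast
        have "\<xi> (- m - L) \<otimes> x \<in> carrier G"
          using x(1) \<xi> by (simp add: C_def)
        then show ?thesis
          using x wc zc d_sym by (metis add.commute)
      qed
      then have "separates ((\<otimes>) (\<xi> (- m - L)) ` C) z W"
        by (simp add: separates_def)
      then show ?thesis by blast
    qed
    then show "\<exists>a b E. a \<in> carrier G \<and> b \<in> carrier G \<and> finite E \<and>
        (\<forall>z\<in>carrier G - E. \<exists>e\<in>{a, b}. separates ((\<otimes>) e ` C) z W)"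
      by (intro exI[of _ "\<xi> m"] exI[of _ "\<xi> (- m - L)"] exI[of _ ?E] conjI ballI \<xi> level)
  qed
qed

end

section \<open>Groups with finitely many Busemann points\<close>

text \<open>\<open>m (k * n)\<close> is within \<open>k * C\<close> of \<open>k * m n\<close> and
  within \<open>n * C\<close> of \<open>n * m k\<close>. Hence the intervals of radius
  \<open>C / n\<close> about \<open>m n / n\<close> meet pairwise, and the supremum \<open>l\<close>
  of their left ends lies in all of them.\<close>

lemma quasi_additive_linear:
  fixes m :: "nat \<Rightarrow> real"
  assumes m: "\<And>a b. \<bar>m (a + b) - m a - m b\<bar> \<le> C"
  obtains l where "\<And>n. \<bar>m n - l * real n\<bar> \<le> C"
proof -
  have C: "0 \<le> C"
    using m[of 0 0] by linarith
  have mult: "\<bar>m (Suc k * n) - real (Suc k) * m n\<bar> \<le> real k * C" for k n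
  proof (induction k)
    case (Suc k)
    have "\<bar>m (n + Suc k * n) - m n - m (Suc k * n)\<bar> \<le> C"
      by (rule m)
    moreover have "n + Suc k * n = Suc (Suc k) * n"
      by simp
    ultimately show ?case
      using Suc by (simp add: algebra_simps)
  qed simp
  have mult': "\<bar>m (k * n) - real k * m n\<bar> \<le> real k * C" if "k \<ge> 1" for k n
    using mult[of "k - 1" n] that C by (simp add: of_nat_diff algebra_simps)
  have le: "(m n - C) / n \<le> (m k + C) / k" if "n \<ge> 1" "k \<ge> 1" for n k
  proof -
    have "real k * (m n - C) \<le> real n * (m k + C)"
      using mult'[OF that(2), of n] mult'[OF that(1), of k] by (simp add: algebra_simps)
    then show ?thesis
      using that by (simp add: field_simps)
  qed
  define l where "l = (SUP n\<in>{1..}. (m n - C) / real n)"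
  have bdd: "bdd_above ((\<lambda>n. (m n - C) / real n) ` {1..})"
    using le[of _ 1] by (intro bdd_aboveI2[of _ _ "(m 1 + C) / real 1"]) auto
  have "\<bar>m n - l * real n\<bar> \<le> C" for n
  proof (cases "n = 0")
    case True
    then show ?thesis
      using m[of 0 0] by simp
  next
    case False
    then have "(m n - C) / real n \<le> l"
      unfolding l_def by (intro cSUP_upper bdd) auto
    moreover have "l \<le> (m n + C) / real n"
      unfolding l_def using False le by (intro cSUP_least) auto
    ultimately show ?thesis
      using False by (simp add: field_simps abs_le_iff)
  qed
  then show ?thesis
    using that by blast
qed

text \<open>The increments over a window of length \<open>R\<close> change by at most 2 when the window is shifted
  by one, so they cannot change sign while their absolute value is at least 2.\<close>
lemma steady_drift:
  fixes f :: "nat \<Rightarrow> real"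
  assumes step: "\<And>i. \<bar>f (Suc i) - f i\<bar> \<le> 1"
    and drift: "\<And>i. i \<le> n \<Longrightarrow> 2 \<le> \<bar>f (i + R) - f i\<bar>"
    and j: "j * R \<le> n"
  shows "2 * real j \<le> \<bar>f (j * R) - f 0\<bar>"
proof -
  \<comment> \<open>The sign of the first increment decides whether \<open>g\<close> will be
    \<open>f\<close> or \<open>- f\<close>.\<close>
  have up: "2 * real j \<le> g (j * R) - g 0"
    if step: "\<And>i. \<bar>g (Suc i) - g i\<bar> \<le> 1" and drift: "\<And>i. i \<le> n \<Longrightarrow> 2 \<le> \<bar>g (i + R) - g i\<bar>"
      and start: "2 \<le> g R - g 0" for g :: "nat \<Rightarrow> real"
  proof -
    have pos: "i \<le> n \<Longrightarrow> 2 \<le> g (i + R) - g i" for i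
    proof (induction i)
      case (Suc i)
      then show ?case
        using step[of i] step[of "i + R"] drift[of "Suc i"] by simp
    qed (use start in simp)
    show ?thesis
      using j
    proof (induction j)
      case (Suc j)
      then show ?case
        using pos[of "j * R"] by (simp add: add.commute)
    qed simp
  qed
  have "2 \<le> f R - f 0 \<or> 2 \<le> - f R - - f 0"
    using drift[of 0] by auto
  then show ?thesis
  proof
    assume "2 \<le> f R - f 0"
    then show ?thesis
      using up[of f] step drift by fastforce
  next
    assume "2 \<le> - f R - - f 0"
    moreover have "\<bar>- f (Suc i) - - f i\<bar> \<le> 1" for i
      using step[of i] by linarith
    moreover have "2 \<le> \<bar>- f (i + R) - - f i\<bar>" if "i \<le> n" for i
      using drift[OF that] by linarith
    ultimately show ?thesis
      using up[of "\<lambda>i. - f i"] by simp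
  qed
qed

lemma nonneg_if_multiples_bounded_below:
  fixes a :: real
  assumes "\<And>k::nat. - C \<le> real k * a"
  shows "0 \<le> a"
proof (rule ccontr)
  assume "\<not> 0 \<le> a"
  then obtain k :: nat where "C < real k * (- a)"
    using reals_Archimedean3[of "- a"] by auto
  then show False
    using assms[of k] by simp
qed

text \<open>On a subgroup \<open>N\<close> this is a homomorphism to the reals. The second argument
  runs over all of \<open>G\<close>, so that values elsewhere are controlled through coset
  representatives.\<close>

definition (in group) left_additive :: "'a set \<Rightarrow> ('a \<Rightarrow> real) \<Rightarrow> bool" where
  "left_additive N \<psi> \<longleftrightarrow> (\<forall>x\<in>N. \<forall>y\<in>carrier G. \<psi> (x \<otimes> y) = \<psi> x + \<psi> y)"

context group
begin

context
  fixes N assumes N: "subgroup N G"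
begin

lemma left_additiveD:
  "\<lbrakk>left_additive N \<psi>; x \<in> N; y \<in> carrier G\<rbrakk> \<Longrightarrow> \<psi> (x \<otimes> y) = \<psi> x + \<psi> y"
  by (simp add: left_additive_def)

lemma left_additive_one: "left_additive N \<psi> \<Longrightarrow> \<psi> \<one> = 0"
  using left_additiveD[of \<psi> \<one> \<one>] subgroup.one_closed[OF N] by simp

lemma left_additive_inv:
  assumes "left_additive N \<psi>" "x \<in> N"
  shows "\<psi> (inv x) = - \<psi> x"
proof -
  have x: "x \<in> carrier G"
    using assms(2) subgroup.mem_carrier[OF N] by simp
  show ?thesis
    using left_additiveD[OF assms, of "inv x"] left_additive_one[OF assms(1)] x by simp
qed

lemma nat_pow_mem_subgroup: "x \<in> N \<Longrightarrow> x [^] (k::nat) \<in> N"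
  using subgroup.one_closed[OF N] subgroup.m_closed[OF N] by (induction k) auto

lemma left_additive_nat_pow:
  assumes "left_additive N \<psi>" "x \<in> N"
  shows "\<psi> (x [^] (k::nat)) = real k * \<psi> x"
proof (induction k)
  case (Suc k)
  have "x \<in> carrier G"
    using assms(2) subgroup.mem_carrier[OF N] by simp
  then show ?case
    using Suc left_additiveD[OF assms(1) nat_pow_mem_subgroup[OF assms(2)], of x]
    by (simp add: algebra_simps)
qed (simp add: left_additive_one[OF assms(1)])

end

end

section \<open>The stabilizer of the Busemann points\<close>

context geodesic_group_metric
begin

text \<open>The kernel of the translation action of \<open>busemann_translate\<close>: the equation
  says that \<open>h (x \<otimes> y) - h x = h y\<close>.\<close>

definition busemann_stabilizer :: "'a set" where
  "busemann_stabilizer =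
     {x \<in> carrier G. \<forall>h\<in>busemann_points G D. \<forall>y\<in>carrier G. h (x \<otimes> y) = h x + h y}"

lemma left_additive_busemann_stabilizer:
  "h \<in> busemann_points G D \<Longrightarrow> left_additive busemann_stabilizer h"
  by (simp add: left_additive_def busemann_stabilizer_def)

lemma subgroup_busemann_stabilizer: "subgroup busemann_stabilizer G"
proof (rule subgroupI)
  show "busemann_stabilizer \<subseteq> carrier G"
    by (auto simp: busemann_stabilizer_def)
  have "\<one> \<in> busemann_stabilizer"
    by (simp add: busemann_stabilizer_def busemann_one)
  then show "busemann_stabilizer \<noteq> {}"
    by blast
next
  fix a assume a: "a \<in> busemann_stabilizer"
  then have ac: "a \<in> carrier G"
    by (simp add: busemann_stabilizer_def)
  have inv: "h (inv a \<otimes> y) = h y - h a" if "h \<in> busemann_points G D" "y \<in> carrier G" for h y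
  proof -
    have "h (a \<otimes> (inv a \<otimes> y)) = h a + h (inv a \<otimes> y)"
      using a that ac by (simp add: busemann_stabilizer_def)
    moreover have "a \<otimes> (inv a \<otimes> y) = y"
      using ac that by (simp flip: m_assoc)
    ultimately show ?thesis
      by simp
  qed
  have "h (inv a \<otimes> y) = h (inv a) + h y" if "h \<in> busemann_points G D" "y \<in> carrier G" for h y
    using inv[OF that] inv[OF that(1) one_closed] busemann_one[OF that(1)] ac by simp
  then show "inv a \<in> busemann_stabilizer"
    using ac by (simp add: busemann_stabilizer_def)
next
  fix a b assume ab: "a \<in> busemann_stabilizer" "b \<in> busemann_stabilizer"
  then have c: "a \<in> carrier G" "b \<in> carrier G"
    by (auto simp: busemann_stabilizer_def)
  have add: "h (x \<otimes> y) = h x + h y"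
    if "x \<in> busemann_stabilizer" "h \<in> busemann_points G D" "y \<in> carrier G" for h x y
    using that by (simp add: busemann_stabilizer_def)
  have "h (a \<otimes> b \<otimes> y) = h (a \<otimes> b) + h y" if h: "h \<in> busemann_points G D" and y: "y \<in> carrier G" for h y
    using add[OF ab(1) h, of "b \<otimes> y"] add[OF ab(2) h y] add[OF ab(1) h c(2)] c y
    by (simp add: m_assoc)
  then show "a \<otimes> b \<in> busemann_stabilizer"
    using c by (simp add: busemann_stabilizer_def)
qed

text \<open>Translation permits only finitely many self-maps \<open>act a\<close> of a finite set.
  If \<open>act y = act t\<close>, then \<open>y \<otimes> inv t\<close> fixes every Busemann point,
  so one \<open>t\<close> for each map suffices.\<close>

lemma busemann_stabilizer_cover:
  assumes fin: "finite (busemann_points G D)"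
  obtains T where "finite T" "T \<subseteq> carrier G"
    "\<And>y. y \<in> carrier G \<Longrightarrow> \<exists>x\<in>busemann_stabilizer. \<exists>t\<in>T. y = x \<otimes> t"
proof -
  define act where
    "act a = (\<lambda>h\<in>busemann_points G D. \<lambda>y\<in>carrier G. h (a \<otimes> y) - h a)" for a
  have "act ` carrier G \<subseteq> busemann_points G D \<rightarrow>\<^sub>E busemann_points G D"
    by (auto simp: act_def busemann_translate)
  moreover have "finite (busemann_points G D \<rightarrow>\<^sub>E busemann_points G D)"
    using fin by (intro finite_PiE)
  ultimately have "finite (act ` carrier G)"
    by (rule finite_subset)
  then obtain T where T: "T \<subseteq> carrier G" "finite T" "act ` carrier G = act ` T"
    using finite_subset_image[of "act ` carrier G" act "carrier G"] by blast
  have "\<exists>x\<in>busemann_stabilizer. \<exists>t\<in>T. y = x \<otimes> t" if y: "y \<in> carrier G" for y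
  proof -
    obtain t where t: "t \<in> T" "act y = act t"
      using T(3) y by (metis imageE imageI)
    have tc: "t \<in> carrier G"
      using t(1) T(1) by blast
    have act_eq: "h (y \<otimes> z) - h y = h (t \<otimes> z) - h t"
      if "h \<in> busemann_points G D" "z \<in> carrier G" for h z
      using fun_cong[OF fun_cong[OF t(2), of h], of z] that by (simp add: act_def)
    have eq: "h (y \<otimes> inv t \<otimes> w) = h w + h y - h t"
      if h: "h \<in> busemann_points G D" and w: "w \<in> carrier G" for h w
    proof -
      have "t \<otimes> (inv t \<otimes> w) = w"
        using tc w by (simp flip: m_assoc)
      then show ?thesis
        using act_eq[OF h, of "inv t \<otimes> w"] tc w y by (simp add: m_assoc)
    qed
    have "y \<otimes> inv t \<in> busemann_stabilizer"
      unfolding busemann_stabilizer_def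
    proof (intro CollectI conjI ballI)
      show "y \<otimes> inv t \<in> carrier G"
        using y tc by simp
      fix h w assume h: "h \<in> busemann_points G D" and w: "w \<in> carrier G"
      have "h (y \<otimes> inv t) = h y - h t"
        using eq[OF h one_closed] busemann_one[OF h] y tc by simp
      then show "h (y \<otimes> inv t \<otimes> w) = h (y \<otimes> inv t) + h w"
        using eq[OF h w] by simp
    qed
    moreover have "y = y \<otimes> inv t \<otimes> t"
      using y tc by (simp add: m_assoc)
    ultimately show ?thesis
      using t(1) by blast
  qed
  then show ?thesis
    using T that by blast
qed

section \<open>Growth of additive functions on a subgroup of finite index\<close>

context
  fixes N T
  assumes N: "subgroup N G" and T: "finite T" "T \<subseteq> carrier G"
    and cover: "\<And>y. y \<in> carrier G \<Longrightarrow> \<exists>x\<in>N. \<exists>t\<in>T. y = x \<otimes> t"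
begin

lemma N_carrier: "x \<in> N \<Longrightarrow> x \<in> carrier G"
  by (rule subgroup.mem_carrier[OF N])

lemma transversal_radius: obtains r :: nat where "\<And>t. t \<in> T \<Longrightarrow> d \<one> t \<le> r"
proof -
  have "bdd_above (d \<one> ` T)"
    using T by simp
  then show ?thesis
    using that unfolding bdd_above_def by auto
qed

text \<open>The maximum \<open>m n\<close> of \<open>\<psi>\<close> on the ball of radius
  \<open>n\<close> is additive up to a constant, because points can be moved into \<open>N\<close>
  at bounded cost. Then \<open>quasi_additive_linear\<close> supplies the rate.\<close>

lemma linear_growth_rate:
  assumes \<psi>: "left_additive N \<psi>"
    and lip: "\<And>y z. \<lbrakk>y \<in> carrier G; z \<in> carrier G\<rbrakk> \<Longrightarrow> \<bar>\<psi> y - \<psi> z\<bar> \<le> L * D y z" and L: "0 \<le> L"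
  obtains l C where "\<And>y. y \<in> carrier G \<Longrightarrow> \<psi> y \<le> l * D \<one> y + C"
    "\<And>n. \<exists>y\<in>carrier G. d \<one> y \<le> n \<and> l * real n - C \<le> \<psi> y"
proof -
  obtain r where r: "\<And>t. t \<in> T \<Longrightarrow> d \<one> t \<le> r"
    using transversal_radius by blast
  have \<psi>T: "\<bar>\<psi> t\<bar> \<le> L * r" if t: "t \<in> T" for t
  proof -
    have "\<bar>\<psi> t\<bar> \<le> L * D \<one> t"
      using lip[of \<one> t] left_additive_one[OF N \<psi>] t T by auto
    also have "\<dots> \<le> L * r"
      using r[OF t] L by (intro mult_left_mono) auto
    finally show ?thesis .
  qed
  define m where "m n = Max (\<psi> ` {y \<in> carrier G. d \<one> y \<le> n})" for n
  have m_ge: "\<psi> y \<le> m n" if "y \<in> carrier G" "d \<one> y \<le> n" for y n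
    unfolding m_def using that finite_ball_one by (intro Max_ge) auto
  have m_attained: "\<exists>y\<in>carrier G. d \<one> y \<le> n \<and> \<psi> y = m n" for n
  proof -
    have "\<one> \<in> {y \<in> carrier G. d \<one> y \<le> n}"
      by simp
    then have "m n \<in> \<psi> ` {y \<in> carrier G. d \<one> y \<le> n}"
      unfolding m_def using finite_ball_one by (intro Max_in) auto
    then show ?thesis
      by auto
  qed
  have split: "\<exists>z\<in>carrier G. d \<one> z \<le> a \<and> d z y \<le> b"
    if y: "y \<in> carrier G" "d \<one> y \<le> a + b" for y a b
  proof -
    obtain z where "z \<in> carrier G" "d \<one> z = min a (d \<one> y)" "d z y = d \<one> y - min a (d \<one> y)"
      using d_between[OF one_closed y(1), of "min a (d \<one> y)"] by auto
    then show ?thesis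
      using y(2) by (intro bexI[of _ z]) auto
  qed
  have m_shift: "m (n + r) \<le> m n + L * r" for n
  proof -
    obtain y where y: "y \<in> carrier G" "d \<one> y \<le> n + r" "\<psi> y = m (n + r)"
      using m_attained by blast
    obtain z where z: "z \<in> carrier G" "d \<one> z \<le> n" "d z y \<le> r"
      using split[OF y(1,2)] by blast
    have "\<bar>\<psi> z - \<psi> y\<bar> \<le> L * D z y"
      by (rule lip[OF z(1) y(1)])
    also have "\<dots> \<le> L * r"
      using z(3) L by (intro mult_left_mono) auto
    finally show ?thesis
      using m_ge[OF z(1,2)] y(3) by linarith
  qed
  \<comment> \<open>Cut a maximizer at \<open>z\<close> and translate its second piece back by the
    \<open>N\<close>-part of \<open>z\<close>. One \<open>L * r\<close> pays for the enlarged ball,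
    the other for \<open>t\<close>.\<close>
  have sub: "m (a + b) \<le> m a + m b + 2 * (L * r)" for a b
  proof -
    obtain y where y: "y \<in> carrier G" "d \<one> y \<le> a + b" "\<psi> y = m (a + b)"
      using m_attained by blast
    obtain z where z: "z \<in> carrier G" "d \<one> z \<le> a" "d z y \<le> b"
      using split[OF y(1,2)] by blast
    obtain x t where xt: "x \<in> N" "t \<in> T" "z = x \<otimes> t"
      using cover[OF z(1)] by blast
    have c: "x \<in> carrier G" "t \<in> carrier G"
      using xt N_carrier T by auto
    define u where "u = inv x \<otimes> y"
    have u: "u \<in> carrier G" "y = x \<otimes> u"
      using y(1) c by (auto simp: u_def simp flip: m_assoc)
    have "d t u = d z y"
      using d_left_mult[OF c(1,2) u(1)] u(2) xt(3) by simp
    then have "d \<one> u \<le> b + r"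
      using d_triangle[OF one_closed c(2) u(1)] r[OF xt(2)] z(3) by simp
    then have "\<psi> u \<le> m b + L * r"
      using m_ge[OF u(1)] m_shift order_trans by blast
    moreover have "\<psi> y = \<psi> x + \<psi> u" "\<psi> z = \<psi> x + \<psi> t"
      using left_additiveD[OF N \<psi> xt(1)] u xt(3) c by auto
    ultimately show ?thesis
      using y(3) m_ge[OF z(1,2)] \<psi>T[OF xt(2)] by linarith
  qed
  \<comment> \<open>The \<open>N\<close>-part of one maximizer is multiplied by the other maximizer,
    with the same two errors.\<close>
  have super: "m a + m b - 2 * (L * r) \<le> m (a + b)" for a b
  proof -
    obtain y where y: "y \<in> carrier G" "d \<one> y \<le> a" "\<psi> y = m a"
      using m_attained by blast
    obtain z where z: "z \<in> carrier G" "d \<one> z \<le> b" "\<psi> z = m b"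
      using m_attained by blast
    obtain x t where xt: "x \<in> N" "t \<in> T" "y = x \<otimes> t"
      using cover[OF y(1)] by blast
    have c: "x \<in> carrier G" "t \<in> carrier G"
      using xt N_carrier T by auto
    have "d \<one> x \<le> d \<one> y + d \<one> t"
      using d_triangle[OF one_closed y(1) c(1)] d_left_mult[OF c(1) one_closed c(2)]
        d_sym[OF y(1) c(1)] xt(3) c by simp
    then have "d \<one> (x \<otimes> z) \<le> a + b + r"
      using d_one_mult[OF c(1) z(1)] y(2) z(2) r[OF xt(2)] by simp
    then have "\<psi> (x \<otimes> z) \<le> m (a + b) + L * r"
      using m_ge[of "x \<otimes> z"] m_shift[of "a + b"] c z(1) by fastforce
    moreover have "\<psi> (x \<otimes> z) = \<psi> x + \<psi> z" "\<psi> y = \<psi> x + \<psi> t"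
      using left_additiveD[OF N \<psi> xt(1)] z(1) xt(3) c by auto
    ultimately show ?thesis
      using y(3) z(3) \<psi>T[OF xt(2)] by linarith
  qed
  have "\<bar>m (a + b) - m a - m b\<bar> \<le> 2 * (L * r)" for a b
    using sub[of a b] super[of a b] by linarith
  then obtain l where l: "\<And>n. \<bar>m n - l * real n\<bar> \<le> 2 * (L * r)"
    using quasi_additive_linear by blast
  show ?thesis
  proof (rule that)
    show "\<psi> y \<le> l * D \<one> y + 2 * (L * r)" if "y \<in> carrier G" for y
      using m_ge[OF that order_refl] l[of "d \<one> y"] by linarith
    show "\<exists>y\<in>carrier G. d \<one> y \<le> n \<and> l * real n - 2 * (L * r) \<le> \<psi> y" for n
    proof -
      obtain y where y: "y \<in> carrier G" "d \<one> y \<le> n" "\<psi> y = m n"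
        using m_attained by blast
      then show ?thesis
        using l[of n] by (intro bexI[of _ y] conjI) linarith+
    qed
  qed
qed

text \<open>Following almost optimal points for \<open>\<psi>\<close> gives a geodesic ray along which \<open>\<psi>\<close> grows at its
  maximal rate \<open>l\<close>. The Busemann function \<open>h\<close> of that ray satisfies \<open>l h + \<psi> \<ge> - C\<close> on \<open>N\<close>, and a
  homomorphism which is bounded below vanishes.\<close>
lemma left_additive_busemann:
  assumes B: "\<And>h. h \<in> busemann_points G D \<Longrightarrow> left_additive N h"
    and \<psi>: "left_additive N \<psi>"
    and lip: "\<And>y z. \<lbrakk>y \<in> carrier G; z \<in> carrier G\<rbrakk> \<Longrightarrow> \<bar>\<psi> y - \<psi> z\<bar> \<le> L * D y z" and L: "0 \<le> L"
    and x0: "x0 \<in> N" "\<psi> x0 \<noteq> 0"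
  shows "\<exists>h\<in>busemann_points G D. \<exists>l>0. \<forall>x\<in>N. \<psi> x = - l * h x"
proof -
  obtain l C where upper: "\<And>y. y \<in> carrier G \<Longrightarrow> \<psi> y \<le> l * D \<one> y + C"
    and lower: "\<And>n. \<exists>y\<in>carrier G. d \<one> y \<le> n \<and> l * real n - C \<le> \<psi> y"
    using linear_growth_rate[OF \<psi> lip L] by blast
  obtain r where r: "\<And>t. t \<in> T \<Longrightarrow> d \<one> t \<le> r"
    using transversal_radius by blast
  have "\<exists>x\<in>N. 0 < \<psi> x"
  proof (cases "0 < \<psi> x0")
    case False
    then show ?thesis
      using x0 left_additive_inv[OF N \<psi> x0(1)] subgroup.m_inv_closed[OF N x0(1)]
      by (intro bexI[of _ "inv x0"]) auto
  qed (use x0 in blast)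
  then obtain x1 where x1: "x1 \<in> N" "0 < \<psi> x1"
    by blast
  \<comment> \<open>Otherwise \<open>\<psi>\<close> would be bounded above, contrary to its growth
    on the powers of \<open>x1\<close>.\<close>
  have l: "0 < l"
  proof (rule ccontr)
    assume "\<not> 0 < l"
    then have "l * D \<one> y \<le> 0" for y
      by (simp add: mult_nonpos_nonneg)
    then have "- C \<le> real k * (- \<psi> x1)" for k
      using upper[of "x1 [^] k"] left_additive_nat_pow[OF N \<psi> x1(1), of k] N_carrier[OF x1(1)]
      by (smt (verit, best) mult_minus_right nat_pow_closed)
    then have "0 \<le> - \<psi> x1"
      by (rule nonneg_if_multiples_bounded_below)
    then show False
      using x1(2) by simp
  qed
  define Y where "Y = {y \<in> carrier G. l * D \<one> y - C \<le> \<psi> y}"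
  have "infinite Y"
  proof
    assume "finite Y"
    then have "bdd_above (\<psi> ` Y)"
      by simp
    then obtain M where M: "\<And>y. y \<in> Y \<Longrightarrow> \<psi> y \<le> M"
      unfolding bdd_above_def by auto
    obtain n :: nat where n: "M + C < real n * l"
      using reals_Archimedean3[OF l] by blast
    obtain y where y: "y \<in> carrier G" "d \<one> y \<le> n" "l * real n - C \<le> \<psi> y"
      using lower by blast
    have "l * D \<one> y \<le> l * real n"
      using y(2) l by (intro mult_left_mono) auto
    then have "y \<in> Y"
      using y by (simp add: Y_def)
    then show False
      using M[of y] y(3) n by (simp add: mult.commute)
  qed
  moreover have "Y \<subseteq> carrier G"
    by (auto simp: Y_def)
  ultimately obtain \<gamma> where \<gamma>: "infinite_geodesic G D \<gamma>" "\<gamma> 0 = \<one>"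
    and near: "\<And>n. infinite {y \<in> Y. n + d (\<gamma> n) y = d \<one> y}"
    using infinite_geodesic_towards[OF one_closed] by metis
  have \<gamma>c: "\<gamma> n \<in> carrier G" for n
    by (rule infinite_geodesicD(1)[OF \<gamma>(1)])
  \<comment> \<open>One \<open>C\<close> comes from the near optimality of \<open>y\<close>, one
    from the upper bound at \<open>u\<close>; \<open>l * r\<close> and \<open>L * r\<close> pay for
    replacing \<open>\<gamma> n\<close> by its \<open>N\<close>-part \<open>x\<close>.\<close>
  define C1 where "C1 = 2 * C + l * r + L * r"
  have fast: "l * real n - C1 \<le> \<psi> (\<gamma> n)" for n
  proof -
    obtain y where y: "y \<in> Y" "n + d (\<gamma> n) y = d \<one> y"
      using near[of n] not_finite_existsD by blast
    obtain x t where xt: "x \<in> N" "t \<in> T" "\<gamma> n = x \<otimes> t"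
      using cover[OF \<gamma>c] by blast
    have c: "x \<in> carrier G" "t \<in> carrier G" "y \<in> carrier G"
      using xt N_carrier T y(1) by (auto simp: Y_def)
    define u where "u = inv x \<otimes> y"
    have u: "u \<in> carrier G" "y = x \<otimes> u"
      using c by (auto simp: u_def simp flip: m_assoc)
    have "d t u = d (\<gamma> n) y"
      using d_left_mult[OF c(1,2) u(1)] u(2) xt(3) by simp
    then have "d \<one> u \<le> r + d (\<gamma> n) y"
      using d_triangle[OF one_closed c(2) u(1)] r[OF xt(2)] by simp
    then have "l * D \<one> u \<le> l * real (r + d (\<gamma> n) y)"
      using l by (intro mult_left_mono) linarith+
    then have "\<psi> u \<le> l * r + l * D (\<gamma> n) y + C"
      using upper[OF u(1)] by (simp add: algebra_simps)
    moreover have "\<psi> y = \<psi> x + \<psi> u" "\<psi> (\<gamma> n) = \<psi> x + \<psi> t"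
      using left_additiveD[OF N \<psi> xt(1)] u xt(3) c by auto
    moreover have "l * real n + l * D (\<gamma> n) y - C \<le> \<psi> y"
    proof -
      have "D \<one> y = real n + D (\<gamma> n) y"
        using y(2) by simp
      then show ?thesis
        using y(1) by (simp add: Y_def distrib_left)
    qed
    moreover have "\<bar>\<psi> t\<bar> \<le> L * r"
    proof -
      have "\<bar>\<psi> t\<bar> \<le> L * D \<one> t"
        using lip[OF one_closed c(2)] left_additive_one[OF N \<psi>] by simp
      also have "\<dots> \<le> L * r"
        using r[OF xt(2)] L by (intro mult_left_mono) auto
      finally show ?thesis .
    qed
    ultimately show ?thesis
      unfolding C1_def by linarith
  qed
  obtain h where h: "busemann_along \<gamma> h"
    using ex_busemann_along[OF \<gamma>(1)] by blast
  then have hB: "h \<in> busemann_points G D"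
    using busemann_points_iff by blast
  \<comment> \<open>The upper bound at \<open>inv x \<otimes> \<gamma> n\<close> is compared with
    the growth along the ray, and \<open>n\<close> tends to infinity.\<close>
  have h_ge: "- (C1 + C) \<le> l * h x + \<psi> x" if x: "x \<in> N" for x
  proof -
    have xc: "x \<in> carrier G"
      using N_carrier[OF x] .
    have "- (C1 + C) - \<psi> x \<le> l * (D (\<gamma> n) x - D (\<gamma> n) \<one>)" for n
    proof -
      have "d \<one> (inv x \<otimes> \<gamma> n) = d (\<gamma> n) x"
        using d_one_inv_mult[OF xc \<gamma>c] d_sym[OF xc \<gamma>c] by simp
      moreover have "d (\<gamma> n) \<one> = n"
        using infinite_geodesicD(2)[OF \<gamma>(1), of 0 n] \<gamma>(2) d_sym[OF \<gamma>c one_closed] by simp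
      moreover have "\<psi> (inv x \<otimes> \<gamma> n) = - \<psi> x + \<psi> (\<gamma> n)"
        using left_additiveD[OF N \<psi> subgroup.m_inv_closed[OF N x] \<gamma>c] left_additive_inv[OF N \<psi> x]
        by simp
      ultimately show ?thesis
        using upper[of "inv x \<otimes> \<gamma> n"] fast[of n] \<gamma>c xc by (simp add: algebra_simps)
    qed
    moreover have "(\<lambda>n. l * (D (\<gamma> n) x - D (\<gamma> n) \<one>)) \<longlonglongrightarrow> l * h x"
      by (intro tendsto_mult_left busemann_alongD(4)[OF h] xc)
    ultimately have "- (C1 + C) - \<psi> x \<le> l * h x"
      by (intro LIMSEQ_le_const) auto
    then show ?thesis
      by linarith
  qed
  \<comment> \<open>Powers of \<open>x\<close> remove the constant; applying the result to
    \<open>inv x\<close> as well gives equality.\<close>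
  have nonneg: "0 \<le> l * h x + \<psi> x" if x: "x \<in> N" for x
  proof (rule nonneg_if_multiples_bounded_below)
    fix k
    show "- (C1 + C) \<le> real k * (l * h x + \<psi> x)"
      using h_ge[OF nat_pow_mem_subgroup[OF N x, of k]] left_additive_nat_pow[OF N \<psi> x, of k]
        left_additive_nat_pow[OF N B[OF hB] x, of k] by (simp add: algebra_simps)
  qed
  have "\<psi> x = - l * h x" if x: "x \<in> N" for x
    using nonneg[OF x] nonneg[OF subgroup.m_inv_closed[OF N x]]
      left_additive_inv[OF N \<psi> x] left_additive_inv[OF N B[OF hB] x] by simp
  then show ?thesis
    using hB l by blast
qed

section \<open>Proportional Busemann points and their level sets\<close>

context
  assumes B: "\<And>h. h \<in> busemann_points G D \<Longrightarrow> left_additive N h"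
    and fin: "finite (busemann_points G D)"
begin

lemma busemann_nonzero:
  assumes h: "h \<in> busemann_points G D"
  shows "\<exists>x\<in>N. h x \<noteq> 0"
proof (rule ccontr)
  assume "\<not> ?thesis"
  then have zero: "h x = 0" if "x \<in> N" for x
    using that by blast
  obtain \<gamma> where \<gamma>: "busemann_along \<gamma> h"
    using h busemann_points_iff by blast
  have "h (\<gamma> n) \<in> h ` T" for n
  proof -
    obtain x t where xt: "x \<in> N" "t \<in> T" "\<gamma> n = x \<otimes> t"
      using cover[OF busemann_alongD(2)[OF \<gamma>]] by blast
    then have "h (\<gamma> n) = h t"
      using left_additiveD[OF N B[OF h] xt(1)] zero T(2) by auto
    then show ?thesis
      using xt(2) by blast
  qed
  then have "range (\<lambda>n. h (\<gamma> n)) \<subseteq> h ` T"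
    by blast
  then have "finite (range (\<lambda>n. h (\<gamma> n)))"
    by (rule finite_surj[OF T(1)])
  moreover have "inj (\<lambda>n. h (\<gamma> n))"
  proof (rule injI)
    fix m n assume "h (\<gamma> m) = h (\<gamma> n)"
    then show "m = n"
      using busemann_along_geodesic[OF \<gamma>, of m] busemann_along_geodesic[OF \<gamma>, of n] by simp
  qed
  ultimately show False
    using finite_imageD infinite_UNIV_nat by blast
qed

text \<open>All the functions \<open>h1 + t h2\<close> with \<open>t\<close> a natural number are negative multiples of Busemann
  points on \<open>N\<close>, of which there are finitely many; hence two of them are proportional.\<close>
lemma busemann_proportional:
  assumes h1: "h1 \<in> busemann_points G D" and h2: "h2 \<in> busemann_points G D"
  shows "\<exists>c. c \<noteq> 0 \<and> (\<forall>x\<in>N. h1 x = c * h2 x)"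
proof -
  \<comment> \<open>In a nontrivial linear relation both coefficients are nonzero, since neither
    function vanishes on \<open>N\<close>.\<close>
  have dependent: "\<exists>c. c \<noteq> 0 \<and> (\<forall>x\<in>N. h1 x = c * h2 x)"
    if "a \<noteq> 0 \<or> b \<noteq> 0" and ab: "\<And>x. x \<in> N \<Longrightarrow> a * h1 x = b * h2 x" for a b
  proof -
    obtain x1 where x1: "x1 \<in> N" "h1 x1 \<noteq> 0"
      using busemann_nonzero[OF h1] by blast
    obtain x2 where x2: "x2 \<in> N" "h2 x2 \<noteq> 0"
      using busemann_nonzero[OF h2] by blast
    have "a \<noteq> 0" "b \<noteq> 0"
      using that(1) ab[OF x1(1)] ab[OF x2(1)] x1(2) x2(2) by auto
    then show ?thesis
      using ab by (intro exI[of _ "b / a"]) (simp add: field_simps)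
  qed
  let ?\<psi> = "\<lambda>t x. h1 x + real t * h2 x"
  show ?thesis
  proof (cases "\<exists>t. \<forall>x\<in>N. ?\<psi> t x = 0")
    case True
    then obtain t where t: "\<And>x. x \<in> N \<Longrightarrow> ?\<psi> t x = 0"
      by blast
    show ?thesis
      by (rule dependent[of 1 "- real t"]) (use t in \<open>auto simp: add_eq_0_iff2\<close>)
  next
    case False
    have "\<exists>h\<in>busemann_points G D. \<exists>l>0. \<forall>x\<in>N. ?\<psi> t x = - l * h x" for t
    proof -
      obtain x0 where x0: "x0 \<in> N" "?\<psi> t x0 \<noteq> 0"
        using False by blast
      have add: "left_additive N (?\<psi> t)"
        using B[OF h1] B[OF h2] by (simp add: left_additive_def algebra_simps)
      have lip: "\<bar>?\<psi> t y - ?\<psi> t z\<bar> \<le> (1 + real t) * D y z"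
        if "y \<in> carrier G" "z \<in> carrier G" for y z
      proof -
        have "\<bar>real t * (h2 y - h2 z)\<bar> \<le> real t * D y z"
          using busemann_lipschitz[OF h2 that] by (simp add: abs_mult mult_left_mono)
        then show ?thesis
          using busemann_lipschitz[OF h1 that] by (simp add: algebra_simps)
      qed
      show ?thesis
        using left_additive_busemann[OF B add lip _ x0] by simp
    qed
    then obtain g l where g: "\<And>t. g t \<in> busemann_points G D" "\<And>t. l t > (0::real)"
      "\<And>t x. x \<in> N \<Longrightarrow> ?\<psi> t x = - l t * g t x"
      by metis
    have "\<not> inj g"
    proof
      assume "inj g"
      then have "infinite (range g)"
        using finite_imageD infinite_UNIV_nat by blast
      then show False
        using g(1) fin finite_subset by (metis image_subsetI)
    qed
    then obtain s t where st: "s \<noteq> t" "g s = g t"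
      by (auto simp: inj_def)
    \<comment> \<open>Eliminating the common Busemann point gives
      \<open>l t * \<psi>_s = l s * \<psi>_t\<close>. If \<open>l s = l t\<close>, the second
      coefficient is \<open>l s * (t - s)\<close>, which is nonzero.\<close>
    show ?thesis
    proof (rule dependent[of "l t - l s" "l s * real t - l t * real s"])
      show "l t - l s \<noteq> 0 \<or> l s * real t - l t * real s \<noteq> 0"
        using st(1) g(2)[of s] by auto
      show "(l t - l s) * h1 x = (l s * real t - l t * real s) * h2 x" if "x \<in> N" for x
      proof -
        have "l t * ?\<psi> s x = l s * ?\<psi> t x"
          using g(3)[OF that, of s] g(3)[OF that, of t] st(2) by simp
        then show ?thesis
          by (simp add: algebra_simps)
      qed
    qed
  qed
qed

text \<open>The finitely many proportionality factors on \<open>N\<close> have a positive minimal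
  absolute value; passing from \<open>y\<close> to its \<open>N\<close>-part costs at most
  \<open>r\<close> for each function.\<close>

lemma busemann_comparable:
  obtains c C where "0 < c"
    "\<And>h1 h2 y. \<lbrakk>h1 \<in> busemann_points G D; h2 \<in> busemann_points G D; y \<in> carrier G\<rbrakk>
      \<Longrightarrow> c * \<bar>h2 y\<bar> - C \<le> \<bar>h1 y\<bar>"
proof -
  let ?B = "busemann_points G D"
  define q where "q h1 h2 = (SOME a. a \<noteq> 0 \<and> (\<forall>x\<in>N. h1 x = a * h2 x))"
    for h1 h2 :: "'a \<Rightarrow> real"
  have q: "q h1 h2 \<noteq> 0 \<and> (\<forall>x\<in>N. h1 x = q h1 h2 * h2 x)" if "h1 \<in> ?B" "h2 \<in> ?B" for h1 h2
    unfolding q_def by (rule someI_ex[OF busemann_proportional[OF that]])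
  define K where "K = insert 1 ((\<lambda>(h1, h2). \<bar>q h1 h2\<bar>) ` (?B \<times> ?B))"
  define c where "c = Min K"
  have K: "finite K" "K \<noteq> {}"
    using fin by (auto simp: K_def)
  have "0 < k" if "k \<in> K" for k
    using that q by (auto simp: K_def)
  then have c: "0 < c"
    unfolding c_def using K Min_in by blast
  have cq: "c \<le> \<bar>q h1 h2\<bar>" if "h1 \<in> ?B" "h2 \<in> ?B" for h1 h2
    unfolding c_def using K that by (intro Min_le) (auto simp: K_def)
  obtain r where r: "\<And>t. t \<in> T \<Longrightarrow> d \<one> t \<le> r"
    using transversal_radius by blast
  have "c * \<bar>h2 y\<bar> - (c * r + r) \<le> \<bar>h1 y\<bar>" if h: "h1 \<in> ?B" "h2 \<in> ?B" and y: "y \<in> carrier G" for h1 h2 y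
  proof -
    obtain x t where xt: "x \<in> N" "t \<in> T" "y = x \<otimes> t"
      using cover[OF y] by blast
    have tc: "t \<in> carrier G"
      using xt(2) T(2) by blast
    have near: "\<bar>h y - h x\<bar> \<le> r" if hB: "h \<in> ?B" for h
    proof -
      have "\<bar>h t\<bar> \<le> D \<one> t"
        using busemann_lipschitz[OF hB one_closed tc] busemann_one[OF hB] by simp
      also have "\<dots> \<le> r"
        using r[OF xt(2)] by simp
      finally show ?thesis
        using left_additiveD[OF N B[OF hB] xt(1) tc] xt(3) by simp
    qed
    have "\<bar>h1 x\<bar> = \<bar>q h1 h2\<bar> * \<bar>h2 x\<bar>"
      using q[OF h] xt(1) by (simp add: abs_mult)
    then have "c * \<bar>h2 x\<bar> \<le> \<bar>h1 x\<bar>"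
      using cq[OF h] by (simp add: mult_right_mono)
    moreover have "c * \<bar>h2 y\<bar> \<le> c * (\<bar>h2 x\<bar> + r)"
      using near[OF h(2)] c by (intro mult_left_mono) auto
    ultimately show ?thesis
      using near[OF h(1)] by (simp add: distrib_left)
  qed
  then show ?thesis
    using that c by blast
qed

text \<open>If \<open>z\<close> lies on geodesics from \<open>\<one>\<close> to infinitely many points, then some Busemann point takes
  the value \<open>- d \<one> z\<close> at \<open>z\<close>, and by comparability every Busemann point is large at \<open>z\<close>.\<close>
lemma busemann_large_on_long_geodesics:
  obtains R R' where "0 < R" "R \<le> R'"
    "\<And>h y z. \<lbrakk>h \<in> busemann_points G D; y \<in> carrier G; z \<in> carrier G; d \<one> z = R;
        R + d z y = d \<one> y; R' \<le> d \<one> y\<rbrakk> \<Longrightarrow> 2 \<le> \<bar>h z\<bar>"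
proof -
  let ?B = "busemann_points G D"
  obtain c C where c: "0 < c"
    and comparable: "\<And>h1 h2 y. \<lbrakk>h1 \<in> ?B; h2 \<in> ?B; y \<in> carrier G\<rbrakk> \<Longrightarrow> c * \<bar>h2 y\<bar> - C \<le> \<bar>h1 y\<bar>"
    using busemann_comparable by blast
  \<comment> \<open>Radius \<open>R\<close> makes \<open>c * R - C \<ge> 2\<close>, so one Busemann
    point of absolute value \<open>R\<close> at \<open>z\<close> forces all others to be at least 2
    there.\<close>
  obtain R0 :: nat where R0: "C + 2 < real R0 * c"
    using reals_Archimedean3[OF c] by blast
  define R where "R = max 1 R0"
  have "real R0 * c \<le> real R * c"
    using c by (intro mult_right_mono) (auto simp: R_def)
  then have R: "2 \<le> c * real R - C" "0 < R"
    using R0 by (auto simp: R_def mult.commute)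
  define cone where "cone z = {y \<in> carrier G. R + d z y = d \<one> y}" for z
  have large: "2 \<le> \<bar>h z\<bar>"
    if h: "h \<in> ?B" and z: "z \<in> carrier G" "d \<one> z = R" and inf: "infinite (cone z)" for h z
  proof -
    have "cone z \<subseteq> carrier G"
      by (auto simp: cone_def)
    then obtain \<gamma> where \<gamma>: "infinite_geodesic G D \<gamma>" "\<gamma> 0 = z"
      and near: "\<And>n. infinite {y \<in> cone z. n + d (\<gamma> n) y = d z y}"
      using infinite_geodesic_towards[OF z(1) _ inf] by metis
    \<comment> \<open>The ray heads towards points of the cone, so it prolongs a geodesic from
      \<one> to \<open>z\<close> and \<open>busemann_along_start\<close> applies.\<close>
    have away: "d \<one> (\<gamma> n) = R + n" for n
    proof -
      obtain y where y: "y \<in> cone z" "n + d (\<gamma> n) y = d z y"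
        using near[of n] not_finite_existsD by blast
      have \<gamma>c: "\<gamma> n \<in> carrier G"
        by (rule infinite_geodesicD(1)[OF \<gamma>(1)])
      have "d z (\<gamma> n) = n"
        using infinite_geodesicD(2)[OF \<gamma>(1), of 0 n] \<gamma>(2) by simp
      then show ?thesis
        using y d_triangle[OF one_closed \<gamma>c, of y] d_triangle[OF one_closed z(1) \<gamma>c] z(2)
        by (auto simp: cone_def)
    qed
    obtain k where k: "busemann_along \<gamma> k"
      using ex_busemann_along[OF \<gamma>(1)] by blast
    then have "k \<in> ?B"
      using busemann_points_iff by blast
    moreover have "k z = - real R"
      using busemann_along_start[OF k away] \<gamma>(2) by simp
    ultimately show ?thesis
      using comparable[OF h _ z(1), of k] R(1) by simp
  qed
  \<comment> \<open>The finite cones of points in the \<open>R\<close>-ball have a finite union, so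
    a point farther out than all of it lies in infinite cones only.\<close>
  define short where "short = (\<Union>z\<in>{z \<in> carrier G. d \<one> z \<le> R \<and> finite (cone z)}. cone z)"
  have "{z \<in> carrier G. d \<one> z \<le> R \<and> finite (cone z)} \<subseteq> {z \<in> carrier G. d \<one> z \<le> R}"
    by blast
  then have "finite {z \<in> carrier G. d \<one> z \<le> R \<and> finite (cone z)}"
    using finite_ball_one finite_subset by blast
  then have "finite short"
    by (auto simp: short_def)
  then have "bdd_above (d \<one> ` short)"
    by simp
  then obtain m where m: "\<And>y. y \<in> short \<Longrightarrow> d \<one> y \<le> m"
    unfolding bdd_above_def by auto
  show ?thesis
  proof (rule that[of R "R + Suc m"])
    fix h y z
    assume *: "h \<in> ?B" "y \<in> carrier G" "z \<in> carrier G" "d \<one> z = R" "R + d z y = d \<one> y"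
      "R + Suc m \<le> d \<one> y"
    then have "y \<in> cone z" "y \<notin> short"
      using m[of y] by (auto simp: cone_def)
    then have "infinite (cone z)"
      using *(3,4) by (auto simp: short_def)
    then show "2 \<le> \<bar>h z\<bar>"
      using large *(1,3,4) by blast
  qed (use R in auto)
qed

text \<open>Along a geodesic from \<one> to a distant \<open>y\<close>, every window of length
  \<open>R\<close> starting at least \<open>R'\<close> before \<open>y\<close> changes
  \<open>h0\<close> by at least 2. By \<open>steady_drift\<close> these changes accumulate, so a
  bound on \<open>h0 y\<close> bounds \<open>d \<one> y\<close>.\<close>

lemma finite_busemann_level:
  assumes h0: "h0 \<in> busemann_points G D"
  shows "finite {y \<in> carrier G. \<bar>h0 y\<bar> \<le> M}"
proof -
  obtain R R' where R: "0 < R" "R \<le> R'" and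
    large: "\<And>h y z. \<lbrakk>h \<in> busemann_points G D; y \<in> carrier G; z \<in> carrier G; d \<one> z = R;
        R + d z y = d \<one> y; R' \<le> d \<one> y\<rbrakk> \<Longrightarrow> 2 \<le> \<bar>h z\<bar>"
    using busemann_large_on_long_geodesics by blast
  \<comment> \<open>The drift over \<open>j\<close> windows will give
    \<open>2 * j \<le> M + R + R'\<close>.\<close>
  define J where "J = nat \<lceil>M + real R + real R'\<rceil>"
  have "d \<one> y \<le> R' + (J + 1) * R" if y: "y \<in> carrier G" "\<bar>h0 y\<bar> \<le> M" for y
  proof (cases "R' \<le> d \<one> y")
    case True
    define n where "n = d \<one> y"
    obtain p where p: "p 0 = \<one>" "\<And>i. p i \<in> carrier G" "\<And>i. d (p i) y = n - i"
      "\<And>i. d (p i) (p (Suc i)) \<le> 1"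
      unfolding n_def using geodesic_segment[OF one_closed y(1)] by blast
    \<comment> \<open>The number of full windows before the last \<open>R'\<close> units, so at most
      \<open>R' + R\<close> units remain uncontrolled.\<close>
    define j where "j = (n - R') div R"
    have j: "j * R \<le> n - R'" "n - R' < R + j * R"
      unfolding j_def using R(1) div_times_less_eq_dividend dividend_less_div_times by blast+
    have "2 * real j \<le> \<bar>h0 (p (j * R)) - h0 (p 0)\<bar>"
    proof (rule steady_drift[of "\<lambda>i. h0 (p i)" "n - R'"])
      show "\<bar>h0 (p (Suc i)) - h0 (p i)\<bar> \<le> 1" for i
        using busemann_lipschitz[OF h0 p(2) p(2), of i "Suc i"] p(4)[of i] by simp
      show "j * R \<le> n - R'"
        by (rule j)
      fix i assume i: "i \<le> n - R'"
      \<comment> \<open>Translation moves the window to the start of a geodesic from \<one> to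
        \<open>u\<close>; the increment of \<open>h0\<close> becomes the value at \<open>z\<close>
        of the translated Busemann point.\<close>
      define z where "z = inv (p i) \<otimes> p (i + R)"
      define u where "u = inv (p i) \<otimes> y"
      have zu: "z \<in> carrier G" "u \<in> carrier G" "p i \<otimes> z = p (i + R)" "p i \<otimes> u = y"
        using p(2) y(1) by (auto simp: z_def u_def simp flip: m_assoc)
      have iR: "i + R \<le> n"
        using i R True by (simp add: n_def)
      have "d (p i) (p (i + R)) = R"
      proof (rule antisym)
        show "d (p i) (p (i + R)) \<le> R"
          using d_le_of_steps[of p i R, OF p(2,4)] .
        show "R \<le> d (p i) (p (i + R))"
          using d_triangle[OF p(2) p(2) y(1), of i "i + R"] p(3)[of i] p(3)[of "i + R"] iR by linarith
      qed
      then have z: "d \<one> z = R"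
        unfolding z_def by (simp add: d_one_inv_mult p(2))
      have u: "d \<one> u = n - i"
        unfolding u_def by (simp add: d_one_inv_mult p(2,3) y(1))
      have "d z u = n - (i + R)"
        using d_left_mult[OF p(2)[of i] zu(1,2)] zu(3,4) p(3)[of "i + R"] by simp
      then have "R + d z u = d \<one> u"
        using u iR by simp
      moreover have "R' \<le> d \<one> u"
        using u i True by (simp add: n_def)
      ultimately have "2 \<le> \<bar>(\<lambda>y\<in>carrier G. h0 (p i \<otimes> y) - h0 (p i)) z\<bar>"
        by (intro large[OF busemann_translate[OF h0 p(2)] zu(2,1) z])
      then show "2 \<le> \<bar>h0 (p (i + R)) - h0 (p i)\<bar>"
        using zu by simp
    qed
    moreover have "\<bar>h0 (p (j * R)) - h0 y\<bar> \<le> real (n - j * R)"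
      using busemann_lipschitz[OF h0 p(2) y(1), of "j * R"] p(3)[of "j * R"] by simp
    moreover have "n - j * R \<le> R' + R"
      using j by simp
    then have "real (n - j * R) \<le> real R' + real R"
      by linarith
    ultimately have "real j \<le> M + real R + real R'"
      using y(2) busemann_one[OF h0] p(1) by simp
    then have "j \<le> J"
      unfolding J_def by linarith
    then have "j * R \<le> J * R"
      by simp
    then have "n \<le> R' + (J * R + R)"
      using j(2) by linarith
    then show ?thesis
      by (simp add: n_def add.commute)
  qed simp
  then have "{y \<in> carrier G. \<bar>h0 y\<bar> \<le> M} \<subseteq> {y \<in> carrier G. d \<one> y \<le> R' + (J + 1) * R}"
    by blast
  then show ?thesis
    using finite_ball_one finite_subset by blast
qed

end

end

end

text \<open>Powers of \<open>x\<close> shift \<open>h\<close> by multiples of \<open>h x\<close>.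
  Hence they are distinct, and every right coset of the subgroup they form meets the finite level
  set.\<close>

lemma (in group) virtually_Z_if_finite_levels:
  assumes x: "x \<in> carrier G" and h: "\<And>y. y \<in> carrier G \<Longrightarrow> h (x \<otimes> y) = h x + h y"
    and hx: "h x \<noteq> (0::real)" and fin: "finite {y \<in> carrier G. \<bar>h y\<bar> \<le> \<bar>h x\<bar>}"
  shows "virtually_Z G"
proof -
  have pow_nat: "h (x [^] k \<otimes> y) = real k * h x + h y" if "y \<in> carrier G" for k :: nat and y
  proof (induction k)
    case (Suc k)
    have "x [^] Suc k \<otimes> y = x \<otimes> (x [^] k \<otimes> y)"
      by (simp only: nat_pow_Suc2[OF x] m_assoc[OF x nat_pow_closed[OF x] that])
    then have "h (x [^] Suc k \<otimes> y) = h x + h (x [^] k \<otimes> y)"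
      using h[of "x [^] k \<otimes> y"] x that by simp
    then show ?case
      using Suc by (simp add: algebra_simps del: nat_pow_Suc)
  qed (use that in simp)
  have pow: "h (x [^] k \<otimes> y) = real_of_int k * h x + h y" if y: "y \<in> carrier G" for k :: int and y
  proof (cases k rule: int_cases2)
    case (nonneg n)
    then show ?thesis
      using pow_nat[OF y] by (simp add: int_pow_int)
  next
    case (nonpos n)
    have "x [^] n \<otimes> (x [^] k \<otimes> y) = y"
      using x y by (simp add: nonpos int_pow_neg int_pow_int flip: m_assoc)
    then show ?thesis
      using pow_nat[of "x [^] k \<otimes> y" n] x y by (simp add: nonpos)
  qed
  define H where "H = range (\<lambda>k::int. x [^] k)"
  have H: "subgroup H G"
    unfolding H_def by (rule subgroup_of_powers[OF x])
  have h1: "h \<one> = 0"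
    using h[OF one_closed] x by simp
  have "inj (\<lambda>k::int. x [^] k)"
  proof (rule injI)
    fix k l :: int assume "x [^] k = x [^] l"
    then show "k = l"
      using pow[OF one_closed, of k] pow[OF one_closed, of l] x hx by simp
  qed
  then have "(\<lambda>k::int. x [^] k) \<in> iso integer_group (G\<lparr>carrier := H\<rparr>)"
    using x by (auto simp: iso_def hom_def bij_betw_def H_def int_pow_mult)
  then have "G\<lparr>carrier := H\<rparr> \<cong> integer_group"
    using group.iso_sym[OF group_integer_group] is_isoI by blast
  moreover have "rcosets H \<subseteq> (\<lambda>y. H #> y) ` {y \<in> carrier G. \<bar>h y\<bar> \<le> \<bar>h x\<bar>}"
  proof
    fix C assume "C \<in> rcosets H"
    then obtain y where y: "y \<in> carrier G" "C = H #> y"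
      by (auto simp: RCOSETS_def)
    \<comment> \<open>Subtracting the integer part of \<open>h y / h x\<close> moves
      \<open>y\<close> within its coset to a point where \<open>h\<close> is at most
      \<open>h x\<close> in absolute value.\<close>
    define q where "q = \<lfloor>h y / h x\<rfloor>"
    have "H #> (x [^] (- q) \<otimes> y) = H #> y"
      using coset_mult_assoc[of H "x [^] (- q)" y] coset_join2[of "x [^] (- q)" H] H x y
        subgroup.subset[OF H] by (simp add: H_def)
    moreover have "h (x [^] (- q) \<otimes> y) = (h y / h x - q) * h x"
      using pow[OF y(1), of "- q"] hx by (simp add: algebra_simps)
    then have "\<bar>h (x [^] (- q) \<otimes> y)\<bar> = \<bar>h y / h x - q\<bar> * \<bar>h x\<bar>"
      by (simp add: abs_mult)
    moreover have "\<bar>h y / h x - q\<bar> \<le> 1"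
      unfolding q_def by linarith
    ultimately show "C \<in> (\<lambda>y. H #> y) ` {y \<in> carrier G. \<bar>h y\<bar> \<le> \<bar>h x\<bar>}"
      using x y by (intro image_eqI[of _ _ "x [^] (- q) \<otimes> y"]) (auto simp: mult_left_le_one_le)
  qed
  then have "finite (rcosets H)"
    using fin finite_surj by blast
  ultimately show ?thesis
    using H unfolding virtually_Z_def by blast
qed

text \<open>Infinitude of the group provides a ray and hence a Busemann point, which is nonzero
  somewhere on the stabilizer and has finite level sets.\<close>

lemma (in geodesic_group_metric) virtually_Z_if_finite_busemann:
  assumes fin: "finite (busemann_points G D)" and inf: "infinite (carrier G)"
  shows "virtually_Z G"
proof -
  obtain T where T: "finite T" "T \<subseteq> carrier G"
    and cover: "\<And>y. y \<in> carrier G \<Longrightarrow> \<exists>x\<in>busemann_stabilizer. \<exists>t\<in>T. y = x \<otimes> t"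
    using busemann_stabilizer_cover[OF fin] by blast
  note stab = subgroup_busemann_stabilizer T cover left_additive_busemann_stabilizer
  obtain \<gamma> where "infinite_geodesic G D \<gamma>"
    using infinite_geodesic_towards[OF one_closed order_refl inf] by blast
  then obtain h where h: "h \<in> busemann_points G D"
    using ex_busemann_along busemann_points_iff by blast
  have "\<exists>x\<in>busemann_stabilizer. h x \<noteq> 0"
    by (rule busemann_nonzero[OF stab fin h])
  then obtain x where x: "x \<in> busemann_stabilizer" "h x \<noteq> 0"
    by blast
  show ?thesis
  proof (rule virtually_Z_if_finite_levels)
    show "h (x \<otimes> y) = h x + h y" if "y \<in> carrier G" for y
      using x(1) h that by (auto simp: busemann_stabilizer_def)
    show "finite {y \<in> carrier G. \<bar>h y\<bar> \<le> \<bar>h x\<bar>}"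
      by (rule finite_busemann_level[OF stab fin h])
  qed (use x in \<open>auto simp: busemann_stabilizer_def\<close>)
qed

section \<open>Generating sets and the equivalence\<close>

lemma (in group) ex_symmetric_generating_set:
  assumes "finitely_generated_group G"
  obtains S where "finite_symmetric_generating_set G S"
proof -
  obtain S where S: "finite S" "S \<subseteq> carrier G" "generate G S = carrier G"
    using assms unfolding finitely_generated_group_def by blast
  let ?S = "S \<union> m_inv G ` S"
  have c: "?S \<subseteq> carrier G"
    using S(2) by auto
  then have "generate G ?S = carrier G"
    using mono_generate[of S ?S] generate_in_carrier[OF c] S(3) by blast
  moreover have "inv s \<in> ?S" if "s \<in> ?S" for s
    using that S(2) by auto
  ultimately show ?thesis
    using S(1) c by (intro that[of ?S]) (simp add: finite_symmetric_generating_set_def)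
qed

theorem theorem1p1:
  fixes G :: "('a, 'b) monoid_scheme"
  assumes "group G"
    and "finitely_generated_group G"
    and "infinite (carrier G)"
  shows "(virtually_Z G \<longleftrightarrow>
            (\<forall>S. finite_symmetric_generating_set G S \<longrightarrow>
               finite (metric_functional_boundary G (cayley_dist G S))))
       \<and> (virtually_Z G \<longleftrightarrow>
            (\<exists>S. finite_symmetric_generating_set G S \<and>
               finite (busemann_points G (cayley_dist G S))))"
proof -
  interpret group G by fact
  obtain S0 where S0: "finite_symmetric_generating_set G S0"
    using ex_symmetric_generating_set[OF assms(2)] by blast
  have D: "cayley_dist G S = (\<lambda>x y. real (graph_dist (cayley_edges G S) x y))" for S
    by (simp add: cayley_dist_def fun_eq_iff)
  have boundary: "finite (metric_functional_boundary G (cayley_dist G S))"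
    if "virtually_Z G" "finite_symmetric_generating_set G S" for S
    unfolding D
    using geodesic_group_metric.virtually_Z_finite_boundary[OF geodesic_group_metric_graph_dist] that
    by blast
  have busemann: "finite (busemann_points G (cayley_dist G S))"
    if "finite (metric_functional_boundary G (cayley_dist G S))" "finite_symmetric_generating_set G S" for S
    using that(1) unfolding D
    by (rule finite_subset[OF geodesic_group_metric.busemann_points_subset_boundary
          [OF geodesic_group_metric_graph_dist[OF that(2)]]])
  have virtually_Z: "virtually_Z G"
    if "finite (busemann_points G (cayley_dist G S))" "finite_symmetric_generating_set G S" for S
    using geodesic_group_metric.virtually_Z_if_finite_busemann
        [OF geodesic_group_metric_graph_dist[OF that(2)]] that(1) assms(3)
    unfolding D by blast
  \<comment> \<open>The implications form a cycle; \<open>S0\<close> is the instance that leads from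
    all generating sets to some generating set.\<close>
  show ?thesis
    using S0 boundary busemann virtually_Z by blast
qed

end
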